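(* Let $A\in\mathcal F\{x,y\}$ be an irreducible differential polynomial such that the differential curve $(\mathcal C,A)$ is unirational, and let $\mathcal P(u)=\big(\frac{P_1(u)}{Q_1(u)},\frac{P_2(u)}{Q_2(u)}\big)$ be a proper differential rational parametrization of $\mathcal C$. Then $$\mathrm{ord}\Big(\frac{P_1(u)}{Q_1(u)}\Big)=\mathrm{ord}_yA,\qquad \mathrm{ord}\Big(\frac{P_2(u)}{Q_2(u)}\Big)=\mathrm{ord}_xA.$$
   Context: $\mathcal F$ is an ordinary differential field of characteristic $0$ with derivation $\delta$, and $\mathcal E$ is a fixed universal differential extension field of $\mathcal F$; $x,y$ are differential indeterminates over $\mathcal E$, and $u\in\mathcal E$ is differentially transcendental over $\mathcal F$. $\mathcal F\{S\}$ and $\mathcal F\langle S\rangle$ denote the differential ring and differential field generated by $S$ over $\mathcal F$; $w^{(k)}=\delta^k(w)$. Orders: for a differential polynomial $f$ and an indeterminate $w$, $\mathrm{ord}_w f$ is the largest $k$ such that $w^{(k)}$ effectively appears in $f$, and $\mathrm{ord}_wf=-\infty$ if no derivative of $w$ (including $w$) appears. For $R(u)\in\mathcal F\langle u\rangle$ written in reduced form $R=P/Q$ ($P,Q\in\mathcal F\{u\}$, $\gcd(P,Q)=1$), $\mathrm{ord}(R)=\mathrm{ord}_u(R)=\max\{\mathrm{ord}_uP,\mathrm{ord}_uQ\}$. Differential curves: for an irreducible $A\in\mathcal F\{x,y\}\setminus\mathcal F$, $\mathrm{sat}(A)=[A]:S_A^\infty=\{f:\exists m,\ S_A^mf\in[A]\}$,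 where $[A]$ is the differential ideal generated by $A$ and $S_A$ is the separant of $A$ (the partial derivative of $A$ with respect to its leader) under some ranking; it is a prime differential ideal independent of the ranking. $(\mathcal C,A)$ denotes the irreducible (plane) differential curve $\mathcal C=\mathbb V(\mathrm{sat}(A))\subset\mathbb A^2(\mathcal E)$, the set of differential zeros of $\mathrm{sat}(A)$. $\mathcal C$ is unirational if it has a generic point of the form $\mathcal P(u)=\big(\frac{P_1(u)}{Q_1(u)},\frac{P_2(u)}{Q_2(u)}\big)\in\mathcal F\langle u\rangle^2$, i.e. the set $\mathbb I(\mathcal P(u))$ of differential polynomials in $\mathcal F\{x,y\}$ vanishing at $\mathcal P(u)$ equals $\mathrm{sat}(A)$; such $\mathcal P(u)$ is called a differential rational parametrization of $\mathcal C$ (or of $A$). It is always assumed that $P_i,Q_i\in\mathcal F\{u\}$ and $\gcd(P_i,Q_i)=1$. The parametrization is proper if $\mathcal F\langle \frac{P_1(u)}{Q_1(u)},\frac{P_2(u)}{Q_2(u)}\rangle=\mathcal F\langle u\rangle$. *)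

theory Defs
  imports
    "HOL-Library.Poly_Mapping"
    "HOL-Library.Extended_Real"
    "HOL-Computational_Algebra.Factorial_Ring"
begin

section \<open>Ordinary differential fields\<close>

class differential_field = field_char_0 +
  fixes der :: "'a \<Rightarrow> 'a"
  assumes der_add: "der (a + b) = der a + der b"
    and der_mult: "der (a * b) = der a * b + a * der b"

text \<open>
  The base field is a type \<open>'f\<close>, its extension a type \<open>'e\<close>, and the inclusion is an
  embedding \<open>\<iota> :: 'f \<Rightarrow> 'e\<close> of differential fields (injectivity is automatic).
\<close>

definition differential_extension ::
    "('f::differential_field \<Rightarrow> 'e::differential_field) \<Rightarrow> bool" where
  "differential_extension \<iota> \<longleftrightarrow>
     \<iota> 1 = 1 \<and> (\<forall>a b. \<iota> (a + b) = \<iota> a + \<iota> b) \<and> (\<forall>a b. \<iota> (a * b) = \<iota> a * \<iota> b) \<and>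
     (\<forall>a. \<iota> (der a) = der (\<iota> a))"

definition differential_subfield :: "'e::differential_field set \<Rightarrow> bool" where
  "differential_subfield K \<longleftrightarrow>
     0 \<in> K \<and> 1 \<in> K \<and> (\<forall>a\<in>K. \<forall>b\<in>K. a + b \<in> K) \<and> (\<forall>a\<in>K. - a \<in> K) \<and>
     (\<forall>a\<in>K. \<forall>b\<in>K. a * b \<in> K) \<and> (\<forall>a\<in>K. inverse a \<in> K) \<and> (\<forall>a\<in>K. der a \<in> K)"

definition diff_field_gen ::
    "('f::differential_field \<Rightarrow> 'e::differential_field) \<Rightarrow> 'e set \<Rightarrow> 'e set" where
  "diff_field_gen \<iota> S = \<Inter>{K. differential_subfield K \<and> \<iota> ` UNIV \<union> S \<subseteq> K}"

section \<open>Differential polynomials\<close>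

text \<open>
  A differential polynomial in indeterminates from \<open>'v\<close> is an ordinary polynomial in the
  variables \<open>(v, k)\<close>, where \<open>(v, k)\<close> stands for the derivative \<open>v\<^sup>(\<^sup>k\<^sup>)\<close>.
  A monomial maps each variable to its exponent.
\<close>

type_synonym ('v, 'a) dpoly = "(('v \<times> nat) \<Rightarrow>\<^sub>0 nat) \<Rightarrow>\<^sub>0 'a"

definition dvar :: "'v \<times> nat \<Rightarrow> ('v, 'a::differential_field) dpoly" where
  "dvar w = Poly_Mapping.single (Poly_Mapping.single w 1) 1"

definition dvars :: "('v, 'a::differential_field) dpoly \<Rightarrow> ('v \<times> nat) set" where
  "dvars f = (\<Union>m\<in>Poly_Mapping.keys f. Poly_Mapping.keys m)"

definition partial_deriv ::
    "'v \<times> nat \<Rightarrow> ('v, 'a::differential_field) dpoly \<Rightarrow> ('v, 'a) dpoly" where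
  "partial_deriv w f =
     (\<Sum>m\<in>Poly_Mapping.keys f.
        Poly_Mapping.single (m - Poly_Mapping.single w 1)
          (of_nat (Poly_Mapping.lookup m w) * Poly_Mapping.lookup f m))"

text \<open>
  The derivation of the differential polynomial ring: it extends \<open>der\<close> on the coefficients and
  sends \<open>v\<^sup>(\<^sup>k\<^sup>)\<close> to \<open>v\<^sup>(\<^sup>k\<^sup>+\<^sup>1\<^sup>)\<close>, so by the chain rule it is the coefficientwise derivation plus
  the sum of the \<open>\<partial>f/\<partial>v\<^sup>(\<^sup>k\<^sup>) \<cdot> v\<^sup>(\<^sup>k\<^sup>+\<^sup>1\<^sup>)\<close>.
\<close>

definition dpoly_der :: "('v, 'a::differential_field) dpoly \<Rightarrow> ('v, 'a) dpoly" where
  "dpoly_der f = Poly_Mapping.map der f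
     + (\<Sum>w\<in>dvars f. partial_deriv w f * dvar (fst w, Suc (snd w)))"

definition dpoly_eval ::
    "('a::differential_field \<Rightarrow> 'e::differential_field) \<Rightarrow> ('v \<Rightarrow> 'e) \<Rightarrow> ('v, 'a) dpoly \<Rightarrow> 'e" where
  "dpoly_eval \<iota> a f =
     (\<Sum>m\<in>Poly_Mapping.keys f. \<iota> (Poly_Mapping.lookup f m) *
        (\<Prod>w\<in>Poly_Mapping.keys m. ((der ^^ snd w) (a (fst w))) ^ Poly_Mapping.lookup m w))"

definition dord :: "'v \<Rightarrow> ('v, 'a::differential_field) dpoly \<Rightarrow> ereal" where
  "dord v f =
     (if {k. (v, k) \<in> dvars f} = {} then - \<infinity>
      else ereal (real (Max {k. (v, k) \<in> dvars f})))"

section \<open>Differential ideals and universal extensions\<close>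

definition differential_ideal ::
    "('v, 'a::differential_field) dpoly set \<Rightarrow> ('v, 'a) dpoly set \<Rightarrow> bool" where
  "differential_ideal R J \<longleftrightarrow>
     J \<subseteq> R \<and> 0 \<in> J \<and> (\<forall>f\<in>J. \<forall>g\<in>J. f + g \<in> J) \<and> (\<forall>r\<in>R. \<forall>f\<in>J. r * f \<in> J) \<and>
     (\<forall>f\<in>J. dpoly_der f \<in> J)"

definition prime_differential_ideal ::
    "('v, 'a::differential_field) dpoly set \<Rightarrow> ('v, 'a) dpoly set \<Rightarrow> bool" where
  "prime_differential_ideal R J \<longleftrightarrow>
     differential_ideal R J \<and> 1 \<notin> J \<and> (\<forall>f\<in>R. \<forall>g\<in>R. f * g \<in> J \<longrightarrow> f \<in> J \<or> g \<in> J)"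

text \<open>\<open>dpolys_over K n\<close> is the ring \<open>K{y\<^sub>0, \<dots>, y\<^sub>n\<^sub>-\<^sub>1}\<close> for a differential subfield \<open>K\<close>.\<close>

definition dpolys_over :: "'e::differential_field set \<Rightarrow> nat \<Rightarrow> (nat, 'e) dpoly set" where
  "dpolys_over K n =
     {f. (\<forall>m. Poly_Mapping.lookup f m \<in> K) \<and> fst ` dvars f \<subseteq> {..<n}}"

text \<open>
  Universality in the sense of Kolchin: every finitely generated differential extension field of
  a finitely generated \<open>K = \<F>\<langle>S\<rangle> \<subseteq> \<E>\<close> embeds in \<open>\<E>\<close> over \<open>K\<close>. The abstract extensions are
  presented as fraction fields of \<open>K{y\<^sub>0, \<dots>, y\<^sub>n\<^sub>-\<^sub>1}/J\<close> with \<open>J\<close> a prime differential ideal; an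
  embedding of such a field is a generic zero of \<open>J\<close> in \<open>\<E>\<^sup>n\<close>.
\<close>

definition universal_extension ::
    "('f::differential_field \<Rightarrow> 'e::differential_field) \<Rightarrow> bool" where
  "universal_extension \<iota> \<longleftrightarrow>
     differential_extension \<iota> \<and>
     (\<forall>S n J. finite S \<longrightarrow>
        prime_differential_ideal (dpolys_over (diff_field_gen \<iota> S) n) J \<longrightarrow>
        (\<exists>a. \<forall>f\<in>dpolys_over (diff_field_gen \<iota> S) n. f \<in> J \<longleftrightarrow> dpoly_eval id a f = 0))"

section \<open>Plane differential curves\<close>

datatype plane_var = Xvar | Yvar

type_synonym 'a plane_dpoly = "(plane_var, 'a) dpoly"

text \<open>\<open>rk p q\<close>: \<open>p\<close> ranks strictly lower than \<open>q\<close>.\<close>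

definition ranking :: "('v \<times> nat \<Rightarrow> 'v \<times> nat \<Rightarrow> bool) \<Rightarrow> bool" where
  "ranking rk \<longleftrightarrow>
     (\<forall>p. \<not> rk p p) \<and> (\<forall>p q r. rk p q \<longrightarrow> rk q r \<longrightarrow> rk p r) \<and>
     (\<forall>p q. p \<noteq> q \<longrightarrow> rk p q \<or> rk q p) \<and>
     (\<forall>v k. rk (v, k) (v, Suc k)) \<and>
     (\<forall>v k w l. rk (v, k) (w, l) \<longrightarrow> rk (v, Suc k) (w, Suc l))"

definition leader ::
    "('v \<times> nat \<Rightarrow> 'v \<times> nat \<Rightarrow> bool) \<Rightarrow> ('v, 'a::differential_field) dpoly \<Rightarrow> 'v \<times> nat" where
  "leader rk A = (THE p. p \<in> dvars A \<and> (\<forall>q\<in>dvars A. q \<noteq> p \<longrightarrow> rk q p))"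

definition separant ::
    "('v \<times> nat \<Rightarrow> 'v \<times> nat \<Rightarrow> bool) \<Rightarrow> ('v, 'a::differential_field) dpoly \<Rightarrow> ('v, 'a) dpoly" where
  "separant rk A = partial_deriv (leader rk A) A"

definition diff_ideal_gen :: "('v, 'a::differential_field) dpoly \<Rightarrow> ('v, 'a) dpoly set" where
  "diff_ideal_gen A = \<Inter>{J. differential_ideal UNIV J \<and> A \<in> J}"

definition sat ::
    "('v \<times> nat \<Rightarrow> 'v \<times> nat \<Rightarrow> bool) \<Rightarrow> ('v, 'a::differential_field) dpoly \<Rightarrow> ('v, 'a) dpoly set" where
  "sat rk A = {f. \<exists>m. separant rk A ^ m * f \<in> diff_ideal_gen A}"

definition zero_set ::
    "('f::differential_field \<Rightarrow> 'e::differential_field) \<Rightarrow> ('v, 'f) dpoly set \<Rightarrow> ('v \<Rightarrow> 'e) set" where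
  "zero_set \<iota> J = {p. \<forall>f\<in>J. dpoly_eval \<iota> p f = 0}"

definition vanishing_ideal ::
    "('f::differential_field \<Rightarrow> 'e::differential_field) \<Rightarrow> ('v \<Rightarrow> 'e) \<Rightarrow> ('v, 'f) dpoly set" where
  "vanishing_ideal \<iota> p = {f. dpoly_eval \<iota> p f = 0}"

definition diff_curve ::
    "('f::differential_field \<Rightarrow> 'e::differential_field) \<Rightarrow>
     (plane_var \<times> nat \<Rightarrow> plane_var \<times> nat \<Rightarrow> bool) \<Rightarrow> 'f plane_dpoly \<Rightarrow> (plane_var \<Rightarrow> 'e) set" where
  "diff_curve \<iota> rk A = zero_set \<iota> (sat rk A)"

definition generic_point ::
    "('f::differential_field \<Rightarrow> 'e::differential_field) \<Rightarrow>
     (plane_var \<times> nat \<Rightarrow> plane_var \<times> nat \<Rightarrow> bool) \<Rightarrow> 'f plane_dpoly \<Rightarrow> (plane_var \<Rightarrow> 'e) \<Rightarrow> bool" where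
  "generic_point \<iota> rk A p \<longleftrightarrow> p \<in> diff_curve \<iota> rk A \<and> vanishing_ideal \<iota> p = sat rk A"

section \<open>Differential rational functions and parametrizations\<close>

definition differentially_transcendental ::
    "('f::differential_field \<Rightarrow> 'e::differential_field) \<Rightarrow> 'e \<Rightarrow> bool" where
  "differentially_transcendental \<iota> u \<longleftrightarrow>
     (\<forall>f :: (unit, 'f) dpoly. dpoly_eval \<iota> (\<lambda>_. u) f = 0 \<longrightarrow> f = 0)"

text \<open>
  As \<open>u\<close> is differentially transcendental, \<open>\<F>{u}\<close> is represented by the differential polynomials
  in one indeterminate, and an element of \<open>\<F>\<langle>u\<rangle>\<close> by numerator and denominator.
\<close>

text \<open>The library constant \<open>coprime\<close> needs a type with a division; this is its unfolding.\<close>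

definition reduced_form ::
    "(unit, 'f::differential_field) dpoly \<Rightarrow> (unit, 'f) dpoly \<Rightarrow> bool" where
  "reduced_form P Q \<longleftrightarrow> Q \<noteq> 0 \<and> (\<forall>d. d dvd P \<longrightarrow> d dvd Q \<longrightarrow> d dvd 1)"

definition frac_eval ::
    "('f::differential_field \<Rightarrow> 'e::differential_field) \<Rightarrow> 'e \<Rightarrow>
     (unit, 'f) dpoly \<Rightarrow> (unit, 'f) dpoly \<Rightarrow> 'e" where
  "frac_eval \<iota> u P Q = dpoly_eval \<iota> (\<lambda>_. u) P / dpoly_eval \<iota> (\<lambda>_. u) Q"

text \<open>The order of \<open>P/Q\<close>; meaningful only when \<open>P/Q\<close> is in reduced form.\<close>

definition frac_ord ::
    "(unit, 'f::differential_field) dpoly \<Rightarrow> (unit, 'f) dpoly \<Rightarrow> ereal" where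
  "frac_ord P Q = max (dord () P) (dord () Q)"

definition rational_parametrization ::
    "('f::differential_field \<Rightarrow> 'e::differential_field) \<Rightarrow> 'e \<Rightarrow>
     (plane_var \<times> nat \<Rightarrow> plane_var \<times> nat \<Rightarrow> bool) \<Rightarrow> 'f plane_dpoly \<Rightarrow>
     (unit, 'f) dpoly \<Rightarrow> (unit, 'f) dpoly \<Rightarrow> (unit, 'f) dpoly \<Rightarrow> (unit, 'f) dpoly \<Rightarrow> bool" where
  "rational_parametrization \<iota> u rk A P\<^sub>1 Q\<^sub>1 P\<^sub>2 Q\<^sub>2 \<longleftrightarrow>
     reduced_form P\<^sub>1 Q\<^sub>1 \<and> reduced_form P\<^sub>2 Q\<^sub>2 \<and>
     generic_point \<iota> rk A (case_plane_var (frac_eval \<iota> u P\<^sub>1 Q\<^sub>1) (frac_eval \<iota> u P\<^sub>2 Q\<^sub>2))"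

definition unirational ::
    "('f::differential_field \<Rightarrow> 'e::differential_field) \<Rightarrow> 'e \<Rightarrow>
     (plane_var \<times> nat \<Rightarrow> plane_var \<times> nat \<Rightarrow> bool) \<Rightarrow> 'f plane_dpoly \<Rightarrow> bool" where
  "unirational \<iota> u rk A \<longleftrightarrow>
     (\<exists>P\<^sub>1 Q\<^sub>1 P\<^sub>2 Q\<^sub>2. rational_parametrization \<iota> u rk A P\<^sub>1 Q\<^sub>1 P\<^sub>2 Q\<^sub>2)"

definition proper_parametrization ::
    "('f::differential_field \<Rightarrow> 'e::differential_field) \<Rightarrow> 'e \<Rightarrow>
     (unit, 'f) dpoly \<Rightarrow> (unit, 'f) dpoly \<Rightarrow> (unit, 'f) dpoly \<Rightarrow> (unit, 'f) dpoly \<Rightarrow> bool" where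
  "proper_parametrization \<iota> u P\<^sub>1 Q\<^sub>1 P\<^sub>2 Q\<^sub>2 \<longleftrightarrow>
     diff_field_gen \<iota> {frac_eval \<iota> u P\<^sub>1 Q\<^sub>1, frac_eval \<iota> u P\<^sub>2 Q\<^sub>2} = diff_field_gen \<iota> {u}"

end

theory Submission
  imports Defs "HOL-Library.Product_Lexorder" "HOL-Computational_Algebra.Polynomial"
begin

text \<open>
  Let \<open>a = P/Q\<close> be the coordinate \<open>v\<close> of the generic point \<open>p\<close>, let \<open>w\<close> be the other
  indeterminate, and let \<open>L = \<F>\<langle>u\<rangle> = \<F>\<langle>p\<rangle>\<close>. Both sides of the asserted equality are the
  dimension of one and the same space, the space \<open>V\<close> of derivations of \<open>L\<close> over \<open>\<F>\<langle>a\<rangle>\<close>. In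
  characteristic zero this dimension is the transcendence degree of \<open>L\<close> over \<open>\<F>\<langle>a\<rangle>\<close>, but working with
  derivations replaces algebraic independence by systems of linear equations.

  The dimension is read off from a differential equation. Suppose that a point generating \<open>L\<close>
  satisfies \<open>B = 0\<close>, where \<open>B\<close> has order \<open>r\<close> in \<open>w\<close>, and that \<open>\<partial>B/\<partial>w\<^sup>(\<^sup>r\<^sup>)\<close> does not vanish there.
  A derivation \<open>\<Delta>\<close> that vanishes on the derivatives of the other coordinates then satisfies the linear
  equations \<open>\<Delta>(B\<^sup>(\<^sup>i\<^sup>)) = 0\<close>, and the equation with index \<open>i\<close> determines \<open>\<Delta>(w\<^sup>(\<^sup>r\<^sup>+\<^sup>i\<^sup>))\<close> from the earlier
  values. So \<open>\<Delta>\<close> is determined by \<open>\<Delta>(w), \<dots>, \<Delta>(w\<^sup>(\<^sup>r\<^sup>-\<^sup>1\<^sup>))\<close> (\<open>derivation_determined_by_equation\<close>), and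
  these values are arbitrary if, up to factors that do not vanish at the point, every relation of the point
  lies in the differential ideal \<open>[B]\<close> (\<open>derivation_interpolation\<close>). Hence \<open>dim V = r\<close>.

  This applies to two equations. For the point \<open>(a, u)\<close> the equation is \<open>Q(w) v - P(w) = 0\<close>, whose
  order in \<open>w\<close> is the order of \<open>P/Q\<close>; its separant does not vanish because \<open>P/Q\<close> is reduced
  (\<open>fraction_equation_properties\<close>). For the point \<open>p\<close> the equation is \<open>A = 0\<close>, whose order in \<open>w\<close> is
  \<open>ord\<^sub>w A\<close>. Here the separant for \<open>w\<close> need not be the one that defines the saturation, and its
  nonvanishing at \<open>p\<close> is shown by elimination: if it lay in the saturation, \<open>A\<close> would divide a
  product of its own nonzero partial derivatives (\<open>partial_deriv_not_in_saturation\<close>). This uses that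
  irreducible polynomials are prime, which is Gauss's lemma applied one variable at a time
  (\<open>irreducible_imp_prime_elem_dpoly\<close>).

  If just one of the two orders is \<open>-\<infinity>\<close>, the same determination arguments would bound the dimension of the
  space of derivations of \<open>\<F>\<langle>u\<rangle>\<close> over \<open>\<F>\<close>. But that space is infinite-dimensional, as a derivation may
  take arbitrary values at all the \<open>u\<^sup>(\<^sup>k\<^sup>)\<close> (\<open>interpolation_transcendental\<close>).
\<close>

section \<open>Differential polynomials as a polynomial ring\<close>

definition dconst :: "'a::differential_field \<Rightarrow> ('v, 'a) dpoly" where
  "dconst c = Poly_Mapping.single 0 c"

definition monom_eval :: "('v \<times> nat \<Rightarrow> 'r::comm_ring_1) \<Rightarrow> ('v \<times> nat \<Rightarrow>\<^sub>0 nat) \<Rightarrow> 'r" where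
  "monom_eval p m = (\<Prod>w\<in>Poly_Mapping.keys m. p w ^ Poly_Mapping.lookup m w)"

text \<open>
  Evaluation under an arbitrary assignment to the \<open>v\<^sup>(\<^sup>k\<^sup>)\<close>, which are treated as independent
  variables, with values in any commutative ring. Besides values at points this covers the substitution of
  polynomials for variables.
\<close>

definition poly_eval ::
    "('a::differential_field \<Rightarrow> 'r::comm_ring_1) \<Rightarrow> ('v \<times> nat \<Rightarrow> 'r) \<Rightarrow> ('v, 'a) dpoly \<Rightarrow> 'r" where
  "poly_eval h p f = (\<Sum>m\<in>Poly_Mapping.keys f. h (Poly_Mapping.lookup f m) * monom_eval p m)"

definition jet :: "('v \<Rightarrow> 'e::differential_field) \<Rightarrow> 'v \<times> nat \<Rightarrow> 'e" where
  "jet p w = (der ^^ snd w) (p (fst w))"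

lemma dpoly_eval_eq: "dpoly_eval \<iota> p f = poly_eval \<iota> (jet p) f"
  by (simp add: dpoly_eval_def poly_eval_def monom_eval_def jet_def)

lemma poly_mapping_single_induct [case_names single add]:
  fixes f :: "'k \<Rightarrow>\<^sub>0 'b::comm_monoid_add"
  assumes single: "\<And>k c. k \<in> Poly_Mapping.keys f \<Longrightarrow> P (Poly_Mapping.single k c)"
    and add: "\<And>f g. P f \<Longrightarrow> P g \<Longrightarrow> P (f + g)"
    and zero: "P 0"
  shows "P f"
proof -
  have eq: "f = (\<Sum>k\<in>Poly_Mapping.keys f. Poly_Mapping.single k (Poly_Mapping.lookup f k))"
    by (rule poly_mapping_eqI)
      (auto simp: lookup_sum lookup_single when_def in_keys_iff sum.delta)
  have "finite K \<Longrightarrow> K \<subseteq> Poly_Mapping.keys f \<Longrightarrow>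
      P (\<Sum>k\<in>K. Poly_Mapping.single k (Poly_Mapping.lookup f k))" for K
    by (induction K rule: finite_induct) (auto intro: single add zero)
  from this[of "Poly_Mapping.keys f"] eq show ?thesis by simp
qed

lemma monom_eval_superset:
  assumes "finite W" "Poly_Mapping.keys m \<subseteq> W"
  shows "monom_eval p m = (\<Prod>w\<in>W. p w ^ Poly_Mapping.lookup m w)"
  unfolding monom_eval_def
  by (rule prod.mono_neutral_left) (use assms in \<open>auto simp: in_keys_iff\<close>)

lemma monom_eval_add: "monom_eval p (m + n) = monom_eval p m * monom_eval p n"
proof -
  let ?W = "Poly_Mapping.keys m \<union> Poly_Mapping.keys n"
  have "monom_eval p (m + n) = (\<Prod>w\<in>?W. p w ^ Poly_Mapping.lookup (m + n) w)"
    by (rule monom_eval_superset) (use Poly_Mapping.keys_add[of m n] in auto)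
  also have "\<dots> = (\<Prod>w\<in>?W. p w ^ Poly_Mapping.lookup m w) * (\<Prod>w\<in>?W. p w ^ Poly_Mapping.lookup n w)"
    by (simp add: lookup_add power_add prod.distrib)
  also have "\<dots> = monom_eval p m * monom_eval p n"
    by (simp add: monom_eval_superset[of ?W])
  finally show ?thesis .
qed

lemma monom_eval_0 [simp]: "monom_eval p 0 = 1"
  by (simp add: monom_eval_def)

lemma monom_eval_single: "monom_eval p (Poly_Mapping.single w 1) = p w"
  by (simp add: monom_eval_def)

lemmas monom_eval_single_Suc [simp] = monom_eval_single[unfolded One_nat_def]

locale coeff_hom =
  fixes h :: "'a::differential_field \<Rightarrow> 'r::comm_ring_1"
  assumes hom_one [simp]: "h 1 = 1"
    and hom_add: "h (a + b) = h a + h b"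
    and hom_mult: "h (a * b) = h a * h b"
begin

lemma hom_zero [simp]: "h 0 = 0"
  using hom_add[of 0 0] by simp

lemma poly_eval_superset:
  assumes "finite M" "Poly_Mapping.keys f \<subseteq> M"
  shows "poly_eval h p f = (\<Sum>m\<in>M. h (Poly_Mapping.lookup f m) * monom_eval p m)"
  unfolding poly_eval_def
  by (rule sum.mono_neutral_left) (use assms in \<open>auto simp: in_keys_iff\<close>)

lemma poly_eval_add: "poly_eval h p (f + g) = poly_eval h p f + poly_eval h p g"
proof -
  let ?M = "Poly_Mapping.keys f \<union> Poly_Mapping.keys g"
  have "poly_eval h p (f + g) = (\<Sum>m\<in>?M. h (Poly_Mapping.lookup (f + g) m) * monom_eval p m)"
    by (rule poly_eval_superset) (use Poly_Mapping.keys_add[of f g] in auto)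
  also have "\<dots> = (\<Sum>m\<in>?M. h (Poly_Mapping.lookup f m) * monom_eval p m)
      + (\<Sum>m\<in>?M. h (Poly_Mapping.lookup g m) * monom_eval p m)"
    by (simp add: lookup_add hom_add sum.distrib distrib_right)
  also have "\<dots> = poly_eval h p f + poly_eval h p g"
    by (simp add: poly_eval_superset[of ?M])
  finally show ?thesis .
qed

lemma poly_eval_single [simp]: "poly_eval h p (Poly_Mapping.single m c) = h c * monom_eval p m"
  by (cases "c = 0") (auto simp: poly_eval_def)

lemma poly_eval_0 [simp]: "poly_eval h p 0 = 0"
  by (simp add: poly_eval_def)

lemma poly_eval_mult: "poly_eval h p (f * g) = poly_eval h p f * poly_eval h p g"
proof (induction f rule: poly_mapping_single_induct)
  case (single k c)
  show ?case
    by (induction g rule: poly_mapping_single_induct)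
      (auto simp: mult_single hom_mult monom_eval_add poly_eval_add algebra_simps)
qed (auto simp: poly_eval_add algebra_simps)

lemma poly_eval_const [simp]: "poly_eval h p (dconst c) = h c"
  by (simp add: dconst_def)

lemma poly_eval_1 [simp]: "poly_eval h p 1 = 1"
  using poly_eval_const[of p 1] by (simp add: dconst_def)

lemma poly_eval_var [simp]: "poly_eval h p (dvar w) = p w"
  by (simp add: dvar_def)

lemma poly_eval_minus: "poly_eval h p (- f) = - poly_eval h p f"
  using poly_eval_add[of p f "- f"] by (simp add: eq_neg_iff_add_eq_0 add.commute)

lemma poly_eval_diff: "poly_eval h p (f - g) = poly_eval h p f - poly_eval h p g"
  using poly_eval_add[of p f "- g"] by (simp add: poly_eval_minus)

lemma poly_eval_power: "poly_eval h p (f ^ n) = poly_eval h p f ^ n"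
  by (induction n) (auto simp: poly_eval_mult)

lemma poly_eval_sum: "poly_eval h p (sum f I) = (\<Sum>i\<in>I. poly_eval h p (f i))"
  by (induction I rule: infinite_finite_induct) (auto simp: poly_eval_add)

end

lemma dconst_simps [simp]: "dconst 0 = 0" "dconst 1 = 1"
  by (auto simp: dconst_def)

lemma dconst_add: "dconst (a + b) = dconst a + dconst b"
  and dconst_mult: "dconst (a * b) = dconst a * dconst b"
  by (auto simp: dconst_def single_add mult_single)

lemma dvars_single: "dvars (Poly_Mapping.single m c) = (if c = 0 then {} else Poly_Mapping.keys m)"
  by (auto simp: dvars_def)

lemma dvars_const [simp]: "dvars (dconst c) = {}"
  by (simp add: dconst_def dvars_single)

lemma dvars_var [simp]: "dvars (dvar w) = {w}"
  by (simp add: dvar_def dvars_single)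

lemma dvars_0 [simp]: "dvars 0 = {}"
  by (simp add: dvars_def)

lemma dvars_1 [simp]: "dvars 1 = {}"
  using dvars_const[of 1] by simp

lemma finite_dvars [simp]: "finite (dvars f)"
  by (simp add: dvars_def)

lemma dvars_add: "dvars (f + g) \<subseteq> dvars f \<union> dvars g"
  using Poly_Mapping.keys_add[of f g] by (auto simp: dvars_def)

lemma dvars_mult: "dvars (f * g) \<subseteq> dvars f \<union> dvars g"
proof
  fix w assume "w \<in> dvars (f * g)"
  then obtain m where m: "m \<in> Poly_Mapping.keys (f * g)" "w \<in> Poly_Mapping.keys m"
    by (auto simp: dvars_def)
  from m(1) obtain a b where "a \<in> Poly_Mapping.keys f" "b \<in> Poly_Mapping.keys g" "m = a + b"
    using Poly_Mapping.keys_mult[of f g] by auto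
  with m(2) show "w \<in> dvars f \<union> dvars g"
    using Poly_Mapping.keys_add[of a b] by (auto simp: dvars_def)
qed

lemma dvars_minus [simp]: "dvars (- f) = dvars f"
  by (simp add: dvars_def Poly_Mapping.keys.rep_eq)

lemma dvars_diff: "dvars (f - g) \<subseteq> dvars f \<union> dvars g"
  using dvars_add[of f "- g"] by simp

lemma dvars_power: "dvars (f ^ n) \<subseteq> dvars f"
proof (induction n)
  case (Suc n)
  then show ?case using dvars_mult[of f "f ^ n"] by auto
qed simp

lemma dvars_sum: "dvars (sum f I) \<subseteq> (\<Union>i\<in>I. dvars (f i))"
proof (induction I rule: infinite_finite_induct)
  case (insert x F)
  then show ?case using dvars_add[of "f x" "sum f F"] by auto
qed auto

text \<open>
  Identities between ring homomorphisms or derivations need only be checked on constants and variables.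
  The set \<open>W\<close> gives the corresponding principle for the subring of polynomials in the variables \<open>W\<close>.
\<close>

lemma dpoly_induct_in [consumes 1, case_names const var add mult]:
  assumes "dvars f \<subseteq> W"
    and const: "\<And>c. P (dconst c)"
    and var: "\<And>w. w \<in> W \<Longrightarrow> P (dvar w)"
    and add: "\<And>f g. dvars f \<subseteq> W \<Longrightarrow> dvars g \<subseteq> W \<Longrightarrow> P f \<Longrightarrow> P g \<Longrightarrow> P (f + g)"
    and mult: "\<And>f g. dvars f \<subseteq> W \<Longrightarrow> dvars g \<subseteq> W \<Longrightarrow> P f \<Longrightarrow> P g \<Longrightarrow> P (f * g)"
  shows "P f"
proof -
  define Q where "Q g \<longleftrightarrow> dvars g \<subseteq> W \<and> P g" for g
  have Qadd: "Q (g + k)" if "Q g" "Q k" for g k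
    using that add dvars_add[of g k] by (auto simp: Q_def)
  have Qmult: "Q (g * k)" if "Q g" "Q k" for g k
    using that mult dvars_mult[of g k] by (auto simp: Q_def)
  have Qconst: "Q (dconst c)" for c by (auto simp: Q_def const)
  have Qvar: "Q (dvar w)" if "w \<in> W" for w using that by (auto simp: Q_def var)
  have Qmon: "Q (Poly_Mapping.single m 1)" if "Poly_Mapping.keys m \<subseteq> W" for m
  proof (induction m rule: poly_mapping_single_induct)
    case (single k c)
    show ?case
    proof (cases "k \<in> W")
      case True
      show ?thesis
      proof (induction c)
        case 0
        then show ?case using Qconst[of 1] by (simp add: dconst_def)
      next
        case (Suc c)
        have "Poly_Mapping.single (Poly_Mapping.single k (Suc c)) 1
            = dvar k * Poly_Mapping.single (Poly_Mapping.single k c) (1::'b)"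
          by (simp add: dvar_def mult_single flip: single_add)
        with Suc Qvar[OF True] show ?case by (simp add: Qmult)
      qed
    qed (use single that in auto)
  next
    case (add f g)
    have "Poly_Mapping.single (f + g) 1 = Poly_Mapping.single f 1 * Poly_Mapping.single g (1::'b)"
      by (simp add: mult_single)
    with add show ?case by (auto intro!: Qmult)
  qed (use Qconst[of 1] in \<open>simp add: dconst_def\<close>)
  have "Q f"
  proof (induction f rule: poly_mapping_single_induct)
    case (single m c)
    have eq: "Poly_Mapping.single m c = dconst c * Poly_Mapping.single m 1"
      by (simp add: dconst_def mult_single)
    have "Poly_Mapping.keys m \<subseteq> W" using single assms(1) by (auto simp: dvars_def)
    then show ?case unfolding eq by (intro Qmult Qconst Qmon)
  qed (use Qadd Qconst[of 0] in auto)
  then show ?thesis by (simp add: Q_def)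
qed

lemma dpoly_induct [case_names const var add mult]:
  assumes "\<And>c. P (dconst c)" "\<And>w. P (dvar w)"
    "\<And>f g. P f \<Longrightarrow> P g \<Longrightarrow> P (f + g)" "\<And>f g. P f \<Longrightarrow> P g \<Longrightarrow> P (f * g)"
  shows "P f"
  by (rule dpoly_induct_in[of f UNIV]) (use assms in auto)

section \<open>Partial derivatives and the derivation\<close>

lemma partial_deriv_superset:
  assumes "finite M" "Poly_Mapping.keys f \<subseteq> M"
  shows "partial_deriv w f = (\<Sum>m\<in>M. Poly_Mapping.single (m - Poly_Mapping.single w 1)
          (of_nat (Poly_Mapping.lookup m w) * Poly_Mapping.lookup f m))"
  unfolding partial_deriv_def
  by (rule sum.mono_neutral_left) (use assms in \<open>auto simp: in_keys_iff\<close>)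

lemma partial_deriv_add: "partial_deriv w (f + g) = partial_deriv w f + partial_deriv w g"
proof -
  let ?M = "Poly_Mapping.keys f \<union> Poly_Mapping.keys g"
  let ?s = "\<lambda>f m. Poly_Mapping.single (m - Poly_Mapping.single w 1)
          (of_nat (Poly_Mapping.lookup m w) * Poly_Mapping.lookup f m)"
  have "partial_deriv w (f + g) = (\<Sum>m\<in>?M. ?s (f + g) m)"
    by (rule partial_deriv_superset) (use Poly_Mapping.keys_add[of f g] in auto)
  also have "\<dots> = (\<Sum>m\<in>?M. ?s f m) + (\<Sum>m\<in>?M. ?s g m)"
    by (simp add: lookup_add distrib_left single_add sum.distrib)
  also have "\<dots> = partial_deriv w f + partial_deriv w g"
    by (simp add: partial_deriv_superset[of ?M])
  finally show ?thesis .
qed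

lemma partial_deriv_0 [simp]: "partial_deriv w 0 = 0"
  by (simp add: partial_deriv_def)

lemma partial_deriv_single:
  "partial_deriv w (Poly_Mapping.single m c) =
    Poly_Mapping.single (m - Poly_Mapping.single w 1) (of_nat (Poly_Mapping.lookup m w) * c)"
  by (cases "c = 0") (auto simp: partial_deriv_def)

lemma partial_deriv_mult:
  "partial_deriv w (f * g) = partial_deriv w f * g + f * partial_deriv w g"
proof (induction f rule: poly_mapping_single_induct)
  case (single m c)
  show ?case
  proof (induction g rule: poly_mapping_single_induct)
    case (single n d)
    have shift: "of_nat (Poly_Mapping.lookup k w) * e = 0 \<or>
        k - Poly_Mapping.single w 1 + l = k + l - Poly_Mapping.single w 1"
      for k l :: "'a \<times> nat \<Rightarrow>\<^sub>0 nat" and e :: 'b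
    proof (cases "Poly_Mapping.lookup k w = 0")
      case False
      then have "k - Poly_Mapping.single w 1 + l = k + l - Poly_Mapping.single w 1"
        by (intro poly_mapping_eqI) (auto simp: lookup_add lookup_minus lookup_single when_def)
      then show ?thesis ..
    qed simp
    have 1: "Poly_Mapping.single (m - Poly_Mapping.single w 1 + n) (of_nat (Poly_Mapping.lookup m w) * (c * d))
        = Poly_Mapping.single (m + n - Poly_Mapping.single w 1) (of_nat (Poly_Mapping.lookup m w) * (c * d))"
      using shift[of m "c * d" n] by (auto simp only: single_zero)
    have 2: "Poly_Mapping.single (m + (n - Poly_Mapping.single w 1)) (of_nat (Poly_Mapping.lookup n w) * (c * d))
        = Poly_Mapping.single (m + n - Poly_Mapping.single w 1) (of_nat (Poly_Mapping.lookup n w) * (c * d))"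
      using shift[of n "c * d" m] by (auto simp only: single_zero add.commute)
    have "partial_deriv w (Poly_Mapping.single m c) * Poly_Mapping.single n d
        + Poly_Mapping.single m c * partial_deriv w (Poly_Mapping.single n d)
      = Poly_Mapping.single (m - Poly_Mapping.single w 1 + n) (of_nat (Poly_Mapping.lookup m w) * (c * d))
        + Poly_Mapping.single (m + (n - Poly_Mapping.single w 1)) (of_nat (Poly_Mapping.lookup n w) * (c * d))"
      by (simp add: partial_deriv_single mult_single mult.assoc mult.left_commute)
    also have "\<dots> = partial_deriv w (Poly_Mapping.single m c * Poly_Mapping.single n d)"
      by (simp add: 1[unfolded One_nat_def] 2[unfolded One_nat_def] partial_deriv_single mult_single lookup_add distrib_right flip: single_add)
    finally show ?case by simp
  qed (auto simp: partial_deriv_add algebra_simps)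
qed (auto simp: partial_deriv_add algebra_simps)

lemma partial_deriv_const [simp]: "partial_deriv w (dconst c) = 0"
  by (simp add: dconst_def partial_deriv_single)

lemma partial_deriv_var: "partial_deriv w (dvar v) = (if v = w then 1 else 0)"
  by (auto simp: dvar_def partial_deriv_single lookup_single)

lemma partial_deriv_minus: "partial_deriv w (- f) = - partial_deriv w f"
  using partial_deriv_add[of w f "- f"] by (simp add: eq_neg_iff_add_eq_0 add.commute)

lemma partial_deriv_diff: "partial_deriv w (f - g) = partial_deriv w f - partial_deriv w g"
  using partial_deriv_add[of w f "- g"] by (simp add: partial_deriv_minus)

lemma dvars_partial_deriv: "dvars (partial_deriv w f) \<subseteq> dvars f"
proof -
  have "Poly_Mapping.keys (m - Poly_Mapping.single w 1) \<subseteq> dvars f"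
    if "m \<in> Poly_Mapping.keys f" for m
    using that by (auto simp: dvars_def in_keys_iff lookup_minus)
  then have "dvars (Poly_Mapping.single (m - Poly_Mapping.single w 1) c) \<subseteq> dvars f"
    if "m \<in> Poly_Mapping.keys f" for m and c :: 'b
    using that by (simp add: dvars_single)
  then show ?thesis
    unfolding partial_deriv_def by (intro order.trans[OF dvars_sum] UN_least)
qed

text \<open>
  Characteristic zero enters here: the exponents brought down by differentiation are nonzero in the
  coefficient field.
\<close>

lemma partial_deriv_eq_0_iff: "partial_deriv w f = 0 \<longleftrightarrow> w \<notin> dvars f"
proof
  assume "w \<notin> dvars f"
  then have "Poly_Mapping.lookup m w = 0" if "m \<in> Poly_Mapping.keys f" for m
    using that by (auto simp: dvars_def in_keys_iff)
  then show "partial_deriv w f = 0" by (simp add: partial_deriv_def)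
next
  assume 0: "partial_deriv w f = 0"
  show "w \<notin> dvars f"
  proof
    assume "w \<in> dvars f"
    then obtain m where m: "m \<in> Poly_Mapping.keys f" "Poly_Mapping.lookup m w \<noteq> 0"
      by (auto simp: dvars_def in_keys_iff)
    let ?e = "Poly_Mapping.single w (1::nat)"
    \<comment> \<open>Monomials that contain \<open>w\<close> remain distinct after division by \<open>w\<close>, so nothing cancels.\<close>
    have *: "Poly_Mapping.lookup (Poly_Mapping.single (n - ?e)
        (of_nat (Poly_Mapping.lookup n w) * Poly_Mapping.lookup f n)) (m - ?e)
        = (if n = m then of_nat (Poly_Mapping.lookup n w) * Poly_Mapping.lookup f n else 0)" for n
    proof (cases "Poly_Mapping.lookup n w = 0")
      case True
      with m(2) show ?thesis by auto
    next
      case False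
      have "n = m" if eq: "n - ?e = m - ?e"
      proof (rule poly_mapping_eqI)
        fix x
        have "Poly_Mapping.lookup (n - ?e) x = Poly_Mapping.lookup (m - ?e) x"
          using eq by simp
        with False m(2) show "Poly_Mapping.lookup n x = Poly_Mapping.lookup m x"
          by (cases "x = w") (auto simp: lookup_minus lookup_single)
      qed
      then show ?thesis by (auto simp: lookup_single when_def)
    qed
    have "Poly_Mapping.lookup (partial_deriv w f) (m - ?e) =
        of_nat (Poly_Mapping.lookup m w) * Poly_Mapping.lookup f m"
      using m(1) by (simp add: partial_deriv_def lookup_sum *[unfolded One_nat_def] sum.delta)
    with 0 m show False by (auto simp: in_keys_iff)
  qed
qed

lemma der_0 [simp]: "der (0::'a::differential_field) = 0"
  using der_add[of "0::'a" 0] by simp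

lemma der_1 [simp]: "der (1::'a::differential_field) = 0"
  using der_mult[of "1::'a" 1] by simp

lemma lookup_map_der: "Poly_Mapping.lookup (Poly_Mapping.map der f) m
    = der (Poly_Mapping.lookup f m :: 'a::differential_field)"
  by (simp add: Poly_Mapping.map.rep_eq when_def)

lemma map_der_0: "Poly_Mapping.map der (0 :: 'k \<Rightarrow>\<^sub>0 'a::differential_field) = 0"
  by (rule poly_mapping_eqI) (simp add: lookup_map_der)

lemma map_der_add: "Poly_Mapping.map der (f + g) = Poly_Mapping.map der f
    + Poly_Mapping.map der (g :: 'k \<Rightarrow>\<^sub>0 'a::differential_field)"
  by (rule poly_mapping_eqI) (simp add: lookup_map_der lookup_add der_add)

lemma map_der_single:
  "Poly_Mapping.map der (Poly_Mapping.single m c)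
     = Poly_Mapping.single m (der c :: 'a::differential_field)"
  by (rule poly_mapping_eqI) (simp add: lookup_map_der lookup_single when_def)

lemma map_der_mult:
  "Poly_Mapping.map der (f * g) = Poly_Mapping.map der f * g
     + f * Poly_Mapping.map der (g :: 'k::comm_monoid_add \<Rightarrow>\<^sub>0 'a::differential_field)"
proof (induction f rule: poly_mapping_single_induct)
  case (single m c)
  show ?case
    by (induction g rule: poly_mapping_single_induct)
      (auto simp: mult_single map_der_single der_mult map_der_add map_der_0 single_add algebra_simps)
qed (auto simp: map_der_add map_der_0 algebra_simps)

lemma dpoly_der_superset:
  assumes "finite W" "dvars f \<subseteq> W"
  shows "dpoly_der f = Poly_Mapping.map der f
     + (\<Sum>w\<in>W. partial_deriv w f * dvar (fst w, Suc (snd w)))"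
proof -
  have "(\<Sum>w\<in>dvars f. partial_deriv w f * dvar (fst w, Suc (snd w)))
      = (\<Sum>w\<in>W. partial_deriv w f * dvar (fst w, Suc (snd w)))"
    by (rule sum.mono_neutral_left) (use assms in \<open>auto simp: partial_deriv_eq_0_iff[THEN iffD2]\<close>)
  then show ?thesis by (simp add: dpoly_der_def)
qed

lemma dpoly_der_add: "dpoly_der (f + g) = dpoly_der f + dpoly_der g"
proof -
  let ?W = "dvars f \<union> dvars g"
  show ?thesis
    using dvars_add[of f g]
    by (simp add: dpoly_der_superset[of ?W] map_der_add partial_deriv_add distrib_right sum.distrib)
qed

lemma dpoly_der_mult: "dpoly_der (f * g) = dpoly_der f * g + f * dpoly_der g"
proof -
  let ?W = "dvars f \<union> dvars g"
  have "dpoly_der (f * g) = Poly_Mapping.map der (f * g)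
     + (\<Sum>w\<in>?W. partial_deriv w (f * g) * dvar (fst w, Suc (snd w)))"
    by (rule dpoly_der_superset) (use dvars_mult[of f g] in auto)
  then show ?thesis
    by (simp add: dpoly_der_superset[of ?W] map_der_mult partial_deriv_mult
        sum.distrib sum_distrib_left sum_distrib_right algebra_simps)
qed

lemma dpoly_der_const [simp]: "dpoly_der (dconst c) = dconst (der c)"
  by (simp add: dpoly_der_def) (simp add: dconst_def map_der_single)

lemma dpoly_der_0 [simp]: "dpoly_der 0 = 0"
  using dpoly_der_const[of 0] by simp

lemma dpoly_der_1 [simp]: "dpoly_der 1 = 0"
  using dpoly_der_const[of 1] by simp

lemma dpoly_der_var [simp]: "dpoly_der (dvar w) = dvar (fst w, Suc (snd w))"
  by (simp add: dpoly_der_def partial_deriv_var) (simp add: dvar_def map_der_single)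

lemma dpoly_der_minus: "dpoly_der (- f) = - dpoly_der f"
  using dpoly_der_add[of f "- f"] by (simp add: eq_neg_iff_add_eq_0 add.commute)

lemma dpoly_der_diff: "dpoly_der (f - g) = dpoly_der f - dpoly_der g"
  using dpoly_der_add[of f "- g"] by (simp add: dpoly_der_minus)

lemma dpoly_der_sum: "dpoly_der (sum f I) = (\<Sum>i\<in>I. dpoly_der (f i))"
  by (induction I rule: infinite_finite_induct) (auto simp: dpoly_der_add)

text \<open>
  The commutator of the two derivations is itself a derivation, and of all the variables it is nonzero only
  on \<open>v\<^sup>(\<^sup>k\<^sup>)\<close>, which the derivation of the ring sends to \<open>v\<^sup>(\<^sup>k\<^sup>+\<^sup>1\<^sup>)\<close>.
\<close>

lemma partial_deriv_dpoly_der_Suc: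
  "partial_deriv (v, Suc k) (dpoly_der f)
     = dpoly_der (partial_deriv (v, Suc k) f) + partial_deriv (v, k) f"
proof (induction f rule: dpoly_induct)
  case (mult f g)
  then show ?case
    by (simp add: partial_deriv_mult partial_deriv_add dpoly_der_mult dpoly_der_add algebra_simps)
qed (auto simp: partial_deriv_add dpoly_der_add partial_deriv_var)

lemma partial_deriv_dpoly_der_0:
  "partial_deriv (v, 0) (dpoly_der f) = dpoly_der (partial_deriv (v, 0) f)"
proof (induction f rule: dpoly_induct)
  case (mult f g)
  then show ?case
    by (simp add: partial_deriv_mult partial_deriv_add dpoly_der_mult dpoly_der_add algebra_simps)
qed (auto simp: partial_deriv_add dpoly_der_add partial_deriv_var)

text \<open>
  Each derivation raises the order by one and, by the commutator formula, leaves the partial derivative at the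
  highest place unchanged. For \<open>i > 0\<close> that makes \<open>B\<^sup>(\<^sup>i\<^sup>)\<close> linear in \<open>w\<^sup>(\<^sup>r\<^sup>+\<^sup>i\<^sup>)\<close>.
\<close>

lemma higher_derivative_order:
  assumes "\<And>k. k > r \<Longrightarrow> (w, k) \<notin> dvars B"
  shows "(\<forall>k > r + i. (w, k) \<notin> dvars ((dpoly_der ^^ i) B)) \<and>
    partial_deriv (w, r + i) ((dpoly_der ^^ i) B) = partial_deriv (w, r) B"
proof (induction i)
  case (Suc i)
  have "partial_deriv (w, k) (dpoly_der ((dpoly_der ^^ i) B)) = 0" if "k > r + Suc i" for k
    using that Suc by (cases k) (auto simp: partial_deriv_dpoly_der_Suc partial_deriv_eq_0_iff[THEN iffD2])
  then have "(w, k) \<notin> dvars (dpoly_der ((dpoly_der ^^ i) B))" if "k > r + Suc i" for k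
    using that by (simp add: partial_deriv_eq_0_iff)
  moreover have "partial_deriv (w, Suc (r + i)) ((dpoly_der ^^ i) B) = 0"
    using Suc by (auto simp: partial_deriv_eq_0_iff)
  ultimately show ?case
    using Suc by (simp add: partial_deriv_dpoly_der_Suc)
qed (use assms in auto)

lemma higher_derivative_avoids:
  assumes "\<And>k. (v, k) \<notin> dvars B"
  shows "(v, k) \<notin> dvars ((dpoly_der ^^ i) B)"
proof (induction i arbitrary: k)
  case (Suc i)
  then show ?case
    by (cases k) (auto simp: partial_deriv_dpoly_der_Suc partial_deriv_dpoly_der_0
        simp flip: partial_deriv_eq_0_iff)
qed (use assms in auto)

text \<open>
  The derivative of the evaluation at \<open>p\<close> in the direction of a tangent vector \<open>\<xi>\<close>: by the chain rule it
  is the value \<open>\<Delta>(f(p))\<close> of a derivation \<open>\<Delta>\<close> with \<open>\<Delta>(p w) = \<xi> w\<close> that vanishes on the coefficients.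
\<close>

definition dir_deriv ::
    "('a::differential_field \<Rightarrow> 'r::comm_ring_1) \<Rightarrow> ('v \<times> nat \<Rightarrow> 'r) \<Rightarrow> ('v \<times> nat \<Rightarrow> 'r) \<Rightarrow>
      ('v, 'a) dpoly \<Rightarrow> 'r" where
  "dir_deriv h p \<xi> f = (\<Sum>w\<in>dvars f. poly_eval h p (partial_deriv w f) * \<xi> w)"

context coeff_hom
begin

lemma dir_deriv_superset:
  assumes "finite W" "dvars f \<subseteq> W"
  shows "dir_deriv h p \<xi> f = (\<Sum>w\<in>W. poly_eval h p (partial_deriv w f) * \<xi> w)"
  unfolding dir_deriv_def
  by (rule sum.mono_neutral_left) (use assms in \<open>auto simp: partial_deriv_eq_0_iff[THEN iffD2]\<close>)

lemma dir_deriv_add: "dir_deriv h p \<xi> (f + g) = dir_deriv h p \<xi> f + dir_deriv h p \<xi> g"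
proof -
  let ?W = "dvars f \<union> dvars g"
  show ?thesis
    using dvars_add[of f g]
    by (simp add: dir_deriv_superset[of ?W] partial_deriv_add poly_eval_add distrib_right sum.distrib)
qed

lemma dir_deriv_mult: "dir_deriv h p \<xi> (f * g)
    = dir_deriv h p \<xi> f * poly_eval h p g + poly_eval h p f * dir_deriv h p \<xi> g"
proof -
  let ?W = "dvars f \<union> dvars g"
  show ?thesis
    using dvars_mult[of f g]
    by (simp add: dir_deriv_superset[of ?W] partial_deriv_mult poly_eval_add poly_eval_mult
        sum.distrib sum_distrib_left sum_distrib_right algebra_simps)
qed

lemma dir_deriv_const [simp]: "dir_deriv h p \<xi> (dconst c) = 0"
  by (simp add: dir_deriv_def)

lemma dir_deriv_0 [simp]: "dir_deriv h p \<xi> 0 = 0"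
  by (simp add: dir_deriv_def)

lemma dir_deriv_1 [simp]: "dir_deriv h p \<xi> 1 = 0"
  by (simp add: dir_deriv_def)

lemma dir_deriv_var [simp]: "dir_deriv h p \<xi> (dvar w) = \<xi> w"
  by (simp add: dir_deriv_def partial_deriv_var)

lemma dir_deriv_minus: "dir_deriv h p \<xi> (- f) = - dir_deriv h p \<xi> f"
  using dir_deriv_add[of p \<xi> f "- f"] by (simp add: eq_neg_iff_add_eq_0 add.commute)

lemma dir_deriv_diff: "dir_deriv h p \<xi> (f - g) = dir_deriv h p \<xi> f - dir_deriv h p \<xi> g"
  using dir_deriv_add[of p \<xi> f "- g"] by (simp add: dir_deriv_minus)

lemma dir_deriv_sum: "dir_deriv h p \<xi> (sum f I) = (\<Sum>i\<in>I. dir_deriv h p \<xi> (f i))"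
  by (induction I rule: infinite_finite_induct) (auto simp: dir_deriv_add)

end

lemma jet_Suc: "jet p (v, Suc k) = der (jet p (v, k))"
  by (simp add: jet_def)

locale diff_hom = coeff_hom \<iota> for \<iota> :: "'a::differential_field \<Rightarrow> 'e::differential_field" +
  assumes hom_der: "\<iota> (der a) = der (\<iota> a)"
begin

lemma poly_eval_dpoly_der: "poly_eval \<iota> (jet p) (dpoly_der f) = der (poly_eval \<iota> (jet p) f)"
proof (induction f rule: dpoly_induct)
  case (var w)
  then show ?case by (cases w) (simp add: jet_Suc)
qed (auto simp: dpoly_der_add dpoly_der_mult poly_eval_add poly_eval_mult der_add der_mult hom_der)

lemma poly_eval_higher_derivative:
  "poly_eval \<iota> (jet p) ((dpoly_der ^^ i) f) = (der ^^ i) (poly_eval \<iota> (jet p) f)"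
  by (induction i) (auto simp: poly_eval_dpoly_der)

end

lemma diff_hom_if_differential_extension: "differential_extension \<iota> \<Longrightarrow> diff_hom \<iota>"
  by unfold_locales (auto simp: differential_extension_def)

lemma higher_der_0 [simp]: "(der ^^ i) 0 = (0::'a::differential_field)"
  by (induction i) auto

section \<open>Polynomials in one distinguished variable\<close>

text \<open>
  A polynomial written as a polynomial in \<open>z\<close>. The coefficients stay in the full ring so that no second type
  is needed; that they do not contain \<open>z\<close> is \<open>dvars_coeff_to_poly\<close>.
\<close>

definition to_poly :: "'v \<times> nat \<Rightarrow> ('v, 'a::differential_field) dpoly \<Rightarrow> ('v, 'a) dpoly poly" where
  "to_poly z = poly_eval (\<lambda>c. [:dconst c:]) (\<lambda>w. if w = z then [:0, 1:] else [:dvar w:])"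

text \<open>
  Multiplying each variable by a new variable turns the total degree into a degree in that variable.
\<close>

definition homogenize :: "('v, 'a::differential_field) dpoly \<Rightarrow> ('v, 'a) dpoly poly" where
  "homogenize = poly_eval (\<lambda>c. [:dconst c:]) (\<lambda>w. [:0, dvar w:])"

lemma coeff_hom_const_poly: "coeff_hom (\<lambda>c. [:dconst c :: ('v, 'a::differential_field) dpoly:])"
  by standard (auto simp: dconst_add dconst_mult one_pCons)

context
  fixes z :: "'v \<times> nat"
begin

interpretation cp: coeff_hom "\<lambda>c. [:dconst c :: ('v, 'a::differential_field) dpoly:]"
  by (rule coeff_hom_const_poly)

lemma to_poly_const [simp]: "to_poly z (dconst c) = [:dconst c:]"
  and to_poly_var: "to_poly z (dvar w) = (if w = z then [:0, 1:] else [:dvar w:])"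
  and to_poly_add: "to_poly z (f + g) = to_poly z f + to_poly z g"
  and to_poly_mult: "to_poly z (f * g) = to_poly z f * to_poly z g"
  and to_poly_0 [simp]: "to_poly z 0 = 0"
  and to_poly_1 [simp]: "to_poly z 1 = 1"
  and to_poly_diff: "to_poly z (f - g) = to_poly z f - to_poly z g"
  and to_poly_power: "to_poly z (f ^ n) = to_poly z f ^ n"
  by (auto simp: to_poly_def cp.poly_eval_add cp.poly_eval_mult cp.poly_eval_diff
      cp.poly_eval_power)

end

context
begin

interpretation cp: coeff_hom "\<lambda>c. [:dconst c :: ('v, 'a::differential_field) dpoly:]"
  by (rule coeff_hom_const_poly)

lemma homogenize_const [simp]: "homogenize (dconst c :: ('v, 'a::differential_field) dpoly) = [:dconst c:]"
  and homogenize_var: "homogenize (dvar w :: ('v, 'a::differential_field) dpoly) = [:0, dvar w:]"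
  and homogenize_add: "homogenize (f + g :: ('v, 'a::differential_field) dpoly) = homogenize f + homogenize g"
  and homogenize_mult: "homogenize (f * g :: ('v, 'a::differential_field) dpoly) = homogenize f * homogenize g"
  and homogenize_1 [simp]: "homogenize (1 :: ('v, 'a::differential_field) dpoly) = 1"
  and homogenize_0 [simp]: "homogenize (0 :: ('v, 'a::differential_field) dpoly) = 0"
  by (auto simp: homogenize_def cp.poly_eval_add cp.poly_eval_mult)

end

lemma poly_to_poly: "poly (to_poly z f) (dvar z) = f"
  by (induction f rule: dpoly_induct) (auto simp: to_poly_add to_poly_mult to_poly_var)

lemma to_poly_inj: "to_poly z f = to_poly z g \<longleftrightarrow> f = g"
  using poly_to_poly by metis

lemma to_poly_eq_0_iff [simp]: "to_poly z f = 0 \<longleftrightarrow> f = 0"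
  using to_poly_inj[of z f 0] by simp

lemma to_poly_free:
  assumes "z \<notin> dvars f"
  shows "to_poly z f = [:f:]"
proof -
  have "dvars f \<subseteq> - {z}" using assms by auto
  then show ?thesis
    by (induction f rule: dpoly_induct_in) (auto simp: to_poly_add to_poly_mult to_poly_var)
qed

lemma dvars_coeff_to_poly: "dvars (coeff (to_poly z f) n) \<subseteq> dvars f - {z}"
proof -
  have "\<forall>n. dvars (coeff (to_poly z f) n) \<subseteq> W - {z}" if "dvars f \<subseteq> W" for W
    using that
  proof (induction f rule: dpoly_induct_in)
    case (const c)
    then show ?case by (auto simp: coeff_pCons split: nat.splits)
  next
    case (var w)
    then show ?case by (auto simp: to_poly_var coeff_pCons split: nat.splits if_splits)
  next
    case (add g k)
    show ?case
    proof
      fix n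
      show "dvars (coeff (to_poly z (g + k)) n) \<subseteq> W - {z}"
        using add(3,4) dvars_add[of "coeff (to_poly z g) n" "coeff (to_poly z k) n"]
        by (simp add: to_poly_add) blast
    qed
  next
    case (mult g k)
    show ?case
    proof
      fix n
      show "dvars (coeff (to_poly z (g * k)) n) \<subseteq> W - {z}"
        unfolding to_poly_mult coeff_mult
        by (intro order.trans[OF dvars_sum] UN_least order.trans[OF dvars_mult] Un_least)
          (use mult(3,4) in auto)
    qed
  qed
  then show ?thesis by blast
qed

lemma poly_homogenize_1: "poly (homogenize f) 1 = f"
  by (induction f rule: dpoly_induct) (auto simp: homogenize_add homogenize_mult homogenize_var)

lemma homogenize_eq_0_iff [simp]: "homogenize f = 0 \<longleftrightarrow> f = 0"
  using poly_homogenize_1[of f] by auto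

lemma poly_homogenize_0: "\<exists>c. poly (homogenize f) 0 = dconst c"
proof (induction f rule: dpoly_induct)
  case (const c)
  then show ?case by auto
next
  case (var w)
  then show ?case by (intro exI[of _ 0]) (simp add: homogenize_var)
next
  case (add f g)
  then show ?case by (metis homogenize_add poly_add dconst_add)
next
  case (mult f g)
  then show ?case by (metis homogenize_mult poly_mult dconst_mult)
qed

definition var_degree :: "'v \<times> nat \<Rightarrow> ('v, 'a::differential_field) dpoly \<Rightarrow> nat" where
  "var_degree z f = degree (to_poly z f)"

definition total_degree :: "('v, 'a::differential_field) dpoly \<Rightarrow> nat" where
  "total_degree f = degree (homogenize f)"

lemma var_degree_eq_0_iff: "var_degree z f = 0 \<longleftrightarrow> z \<notin> dvars f"
proof
  assume "var_degree z f = 0"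
  then obtain c where c: "to_poly z f = [:c:]"
    unfolding var_degree_def by (rule degree_eq_zeroE)
  have "poly [:c:] (dvar z) = f" using poly_to_poly[of z f] by (simp only: c)
  then have cf: "c = f" by (simp only: poly_pCons poly_0 mult_zero_right add_0_right)
  have "coeff (to_poly z f) 0 = f" by (simp only: c cf coeff_pCons_0)
  then show "z \<notin> dvars f" using dvars_coeff_to_poly[of z f 0] by auto
next
  assume "z \<notin> dvars f"
  then have "to_poly z f = [:f:]" by (rule to_poly_free)
  then show "var_degree z f = 0" by (simp only: var_degree_def degree_pCons_0)
qed

lemma dconst_dvd_1: "c \<noteq> 0 \<Longrightarrow> dconst c dvd 1"
  by (rule dvdI[of _ _ "dconst (inverse c)"], subst dconst_mult[symmetric]) simp

lemma dpoly_const_if_total_degree_0: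
  assumes "total_degree f = 0"
  shows "\<exists>c. f = dconst c"
proof -
  obtain g where g: "homogenize f = [:g:]"
    using assms unfolding total_degree_def by (rule degree_eq_zeroE)
  have "poly (homogenize f) 1 = poly (homogenize f) 0" unfolding g by simp
  moreover obtain c where "poly (homogenize f) 0 = dconst c" using poly_homogenize_0[of f] by blast
  ultimately have "f = dconst c" using poly_homogenize_1[of f] by (simp only:)
  then show ?thesis by blast
qed

lemma dpoly_const_if_dvars_empty:
  assumes "dvars f = {}"
  shows "\<exists>c. f = dconst c"
proof -
  have "dvars f \<subseteq> {}" using assms by simp
  then show ?thesis
  proof (induction f rule: dpoly_induct_in)
    case (add f g)
    then obtain c d where "f = dconst c" "g = dconst d" by blast
    then show ?case using dconst_add[of c d] by metis
  next
    case (mult f g)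
    then obtain c d where "f = dconst c" "g = dconst d" by blast
    then show ?case using dconst_mult[of c d] by metis
  qed blast+
qed

text \<open>
  A linear order of the variables orders the monomials; leading monomials multiply, so there are no zero
  divisors and degrees add.
\<close>

lemma var_degree_mult:
  fixes f g :: "('v::linorder, 'a::differential_field) dpoly"
  shows "f \<noteq> 0 \<Longrightarrow> g \<noteq> 0 \<Longrightarrow> var_degree z (f * g) = var_degree z f + var_degree z g"
  by (simp add: var_degree_def to_poly_mult degree_mult_eq)

lemma total_degree_mult:
  fixes f g :: "('v::linorder, 'a::differential_field) dpoly"
  shows "f \<noteq> 0 \<Longrightarrow> g \<noteq> 0 \<Longrightarrow> total_degree (f * g) = total_degree f + total_degree g"
  by (simp add: total_degree_def homogenize_mult degree_mult_eq)

lemma dvars_factor: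
  fixes f g :: "('v::linorder, 'a::differential_field) dpoly"
  assumes "f * g \<noteq> 0"
  shows "dvars (f * g) = dvars f \<union> dvars g"
proof (rule set_eqI)
  fix w
  have "f \<noteq> 0" "g \<noteq> 0" using assms by auto
  then have "var_degree w (f * g) = 0 \<longleftrightarrow> var_degree w f = 0 \<and> var_degree w g = 0"
    by (simp add: var_degree_mult)
  then show "w \<in> dvars (f * g) \<longleftrightarrow> w \<in> dvars f \<union> dvars g"
    unfolding var_degree_eq_0_iff by blast
qed

lemma total_degree_eq_0_iff:
  fixes f :: "('v::linorder, 'a::differential_field) dpoly"
  assumes "f \<noteq> 0"
  shows "total_degree f = 0 \<longleftrightarrow> f dvd 1"
proof
  assume "total_degree f = 0"
  then obtain c where c: "f = dconst c" using dpoly_const_if_total_degree_0[of f] by auto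
  with assms have "c \<noteq> 0" by auto
  with c show "f dvd 1" using dconst_dvd_1[of c] by simp
next
  assume "f dvd 1"
  then obtain g where "1 = f * g" by (rule dvdE)
  then have g: "f * g = 1" by (rule sym)
  from g have "g \<noteq> 0" by auto
  have "total_degree (1 :: ('v, 'a) dpoly) = 0"
    by (simp add: total_degree_def)
  with g total_degree_mult[OF assms \<open>g \<noteq> 0\<close>] show "total_degree f = 0" by simp
qed

lemma dvd_1_dvars:
  fixes f :: "('v::linorder, 'a::differential_field) dpoly"
  assumes "f dvd 1"
  shows "dvars f = {}"
proof -
  from assms obtain g where "1 = f * g" by (rule dvdE)
  then have g: "f * g = 1" by (rule sym)
  then have "dvars f \<union> dvars g = dvars (1 :: ('v, 'a) dpoly)"
    using dvars_factor[of f g] by simp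
  then show ?thesis by simp
qed

lemma irreducible_factor_exists:
  fixes f :: "('v::linorder, 'a::differential_field) dpoly"
  assumes "f \<noteq> 0" "\<not> f dvd 1"
  shows "\<exists>p. irreducible p \<and> p dvd f"
  using assms
proof (induction "total_degree f" arbitrary: f rule: less_induct)
  case less
  show ?case
  proof (cases "irreducible f")
    case False
    with less.prems obtain a b where ab: "f = a * b" "\<not> a dvd 1" "\<not> b dvd 1"
      unfolding irreducible_def by blast
    with less.prems(1) have "a \<noteq> 0" "b \<noteq> 0" by auto
    then have "total_degree a < total_degree f"
      using ab total_degree_mult[of a b] total_degree_eq_0_iff[of b] by simp
    then obtain p where "irreducible p" "p dvd a"
      using less.hyps[of a] \<open>a \<noteq> 0\<close> ab(2) by blast
    then show ?thesis unfolding ab(1) by (intro exI[of _ p] conjI dvd_mult2)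
  next
    case True
    then show ?thesis by (intro exI[of _ f] conjI dvd_refl)
  qed
qed

section \<open>Unique factorization\<close>

text \<open>
  Primality relative to the subring of polynomials in the variables \<open>W\<close>. Relative to a finite \<open>W\<close>, and hence
  in general, irreducible polynomials are prime by induction: \<open>W\<close> is enlarged by one variable at a time.
\<close>

definition prime_over ::
    "('v \<times> nat) set \<Rightarrow> ('v, 'a::differential_field) dpoly \<Rightarrow> bool" where
  "prime_over W p \<longleftrightarrow> (\<forall>f g. dvars f \<subseteq> W \<longrightarrow> dvars g \<subseteq> W \<longrightarrow> p dvd f * g \<longrightarrow> p dvd f \<or> p dvd g)"

lemma dvd_iff_dvd_coeffs:
  assumes "z \<notin> dvars p"
  shows "p dvd f \<longleftrightarrow> (\<forall>n. p dvd coeff (to_poly z f) n)"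
proof
  assume "p dvd f"
  then obtain g where "f = p * g" by (rule dvdE)
  then have "to_poly z f = smult p (to_poly z g)"
    by (simp add: to_poly_mult to_poly_free[OF assms])
  then show "\<forall>n. p dvd coeff (to_poly z f) n" by simp
next
  assume "\<forall>n. p dvd coeff (to_poly z f) n"
  then have "p dvd poly (to_poly z f) (dvar z)"
    unfolding poly_altdef by (intro dvd_sum dvd_mult2) blast
  then show "p dvd f" by (simp only: poly_to_poly)
qed

text \<open>
  The product of the first coefficients of \<open>f\<close> and \<open>g\<close> that \<open>p\<close> does not divide is, modulo \<open>p\<close>, a
  coefficient of \<open>f * g\<close>.
\<close>

lemma prime_over_insert:
  assumes "prime_over W p" "z \<notin> dvars p"
  shows "prime_over (insert z W) p"
  unfolding prime_over_def
proof (intro allI impI)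
  fix f g assume f: "dvars f \<subseteq> insert z W" and g: "dvars g \<subseteq> insert z W" and fg: "p dvd f * g"
  show "p dvd f \<or> p dvd g"
  proof (rule ccontr)
    assume "\<not> (p dvd f \<or> p dvd g)"
    then have ex: "\<exists>n. \<not> p dvd coeff (to_poly z f) n" "\<exists>n. \<not> p dvd coeff (to_poly z g) n"
      using dvd_iff_dvd_coeffs[OF assms(2)] by blast+
    define i where "i = (LEAST n. \<not> p dvd coeff (to_poly z f) n)"
    define j where "j = (LEAST n. \<not> p dvd coeff (to_poly z g) n)"
    let ?F = "coeff (to_poly z f)" and ?G = "coeff (to_poly z g)"
    have i: "\<not> p dvd ?F i" "\<And>k. k < i \<Longrightarrow> p dvd ?F k"
      unfolding i_def using LeastI_ex[OF ex(1)] not_less_Least by blast+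
    have j: "\<not> p dvd ?G j" "\<And>k. k < j \<Longrightarrow> p dvd ?G k"
      unfolding j_def using LeastI_ex[OF ex(2)] not_less_Least by blast+
    have "p dvd coeff (to_poly z (f * g)) (i + j)"
      using fg dvd_iff_dvd_coeffs[OF assms(2)] by blast
    also have "coeff (to_poly z (f * g)) (i + j) = (\<Sum>k\<le>i + j. ?F k * ?G (i + j - k))"
      by (simp only: to_poly_mult coeff_mult)
    also have "\<dots> = ?F i * ?G j + (\<Sum>k\<in>{..i + j} - {i}. ?F k * ?G (i + j - k))"
      by (subst sum.remove[of _ i]) auto
    finally have "p dvd ?F i * ?G j + (\<Sum>k\<in>{..i + j} - {i}. ?F k * ?G (i + j - k))" .
    moreover have "p dvd (\<Sum>k\<in>{..i + j} - {i}. ?F k * ?G (i + j - k))"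
    proof (rule dvd_sum)
      fix k assume "k \<in> {..i + j} - {i}"
      then consider "k < i" | "i + j - k < j" by fastforce
      then show "p dvd ?F k * ?G (i + j - k)"
        by cases (auto intro: i j dvd_mult dvd_mult2)
    qed
    ultimately have "p dvd ?F i * ?G j" using dvd_add_left_iff by blast
    moreover have "dvars (?F i) \<subseteq> W" "dvars (?G j) \<subseteq> W"
      using dvars_coeff_to_poly[of z f i] dvars_coeff_to_poly[of z g j] f g by blast+
    ultimately show False using assms(1) i(1) j(1) unfolding prime_over_def by blast
  qed
qed

text \<open>
  Division with remainder with respect to \<open>z\<close>; powers of the leading coefficient of the divisor take the place
  of its inverse.
\<close>

lemma pseudo_division:
  assumes "h \<noteq> 0" "dvars h \<subseteq> V" "z \<in> V" "dvars f \<subseteq> V"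
  shows "\<exists>k q r. lead_coeff (to_poly z h) ^ k * f = q * h + r
     \<and> (r = 0 \<or> var_degree z r < var_degree z h) \<and> dvars r \<subseteq> V"
  using assms(4)
proof (induction "var_degree z f" arbitrary: f rule: less_induct)
  case less
  let ?c = "lead_coeff (to_poly z h)"
  show ?case
  proof (cases "var_degree z f < var_degree z h")
    case True
    then show ?thesis
      by (intro exI[of _ 0] exI[of _ "0::('a, 'b) dpoly"] exI[of _ f]) (use less.prems in simp)
  next
    case False
    define n where "n = var_degree z f"
    define d where "d = var_degree z h"
    \<comment> \<open>The multiple \<open>t * h\<close> cancels the leading term of \<open>f\<close>.\<close>
    define t where "t = lead_coeff (to_poly z f) * dvar z ^ (n - d)"
    define f1 where "f1 = ?c * f - t * h"
    have zc: "z \<notin> dvars (coeff (to_poly z k) m)" for k :: "('a, 'b) dpoly" and m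
      using dvars_coeff_to_poly[of z k m] by blast
    have t: "to_poly z t = monom (lead_coeff (to_poly z f)) (n - d)"
      unfolding t_def
      by (simp add: to_poly_mult to_poly_power to_poly_var to_poly_free[OF zc] monom_altdef)
    have F1: "to_poly z f1 = smult ?c (to_poly z f) - to_poly z t * to_poly z h"
      unfolding f1_def by (simp add: to_poly_diff to_poly_mult to_poly_free[OF zc])
    have nd: "d \<le> n" using False unfolding n_def d_def by simp
    have "degree (to_poly z t * to_poly z h) \<le> n"
      using degree_mult_le[of "to_poly z t" "to_poly z h"] degree_monom_le[of "lead_coeff (to_poly z f)" "n - d"] nd
      unfolding t d_def var_degree_def by linarith
    then have deg: "degree (to_poly z f1) \<le> n"
      unfolding F1 by (intro degree_diff_le) (auto simp: n_def var_degree_def intro: order.trans[OF degree_smult_le])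
    have "coeff (to_poly z f1) n = 0"
      using nd unfolding F1 t
      by (simp add: coeff_monom_mult n_def d_def var_degree_def)
    with deg have small: "f1 = 0 \<or> var_degree z f1 < n"
      using eq_zero_or_degree_less[of "to_poly z f1" n] unfolding var_degree_def to_poly_eq_0_iff by blast
    have tV: "dvars t \<subseteq> V"
      unfolding t_def
      using dvars_mult[of "lead_coeff (to_poly z f)" "dvar z ^ (n - d)"]
        dvars_power[of "dvar z" "n - d"] dvars_coeff_to_poly[of z f] less.prems assms(3)
      by fastforce
    have cV: "dvars ?c \<subseteq> V" using dvars_coeff_to_poly[of z h] assms(2) by blast
    have f1V: "dvars f1 \<subseteq> V"
      using dvars_diff[of "?c * f" "t * h"] dvars_mult[of ?c f] dvars_mult[of t h]
        less.prems assms(2) tV cV unfolding f1_def by blast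
    obtain k q r where kqr: "?c ^ k * f1 = q * h + r"
        "r = 0 \<or> var_degree z r < var_degree z h" "dvars r \<subseteq> V"
    proof (cases "f1 = 0")
      case True
      then show ?thesis using that[of 0 0 0] by simp
    next
      case False
      then show ?thesis using small less.hyps[of f1] f1V that unfolding n_def by blast
    qed
    have "?c ^ Suc k * f = (q + ?c ^ k * t) * h + r"
      using kqr(1) unfolding f1_def by (simp add: algebra_simps)
    with kqr show ?thesis by blast
  qed
qed

lemma irreducible_not_dvd_if_more_vars:
  fixes A p :: "('v::linorder, 'a::differential_field) dpoly"
  assumes "irreducible A" "\<not> dvars A \<subseteq> W" "irreducible p" "dvars p \<subseteq> W"
  shows "\<not> p dvd A"
proof
  assume "p dvd A"
  then obtain s where s: "A = p * s" by (rule dvdE)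
  have "\<not> p dvd 1" using assms(3) unfolding irreducible_def by blast
  with assms(1) s have "s dvd 1" unfolding irreducible_def by blast
  then have "dvars s = {}" by (rule dvd_1_dvars)
  with s dvars_mult[of p s] assms(2,4) show False by blast
qed

lemma irreducible_factor_induct [consumes 1, case_names unit mult]:
  fixes c :: "('v::linorder, 'a::differential_field) dpoly"
  assumes "c \<noteq> 0"
    and unit: "\<And>c. c dvd 1 \<Longrightarrow> P c"
    and mult: "\<And>p c. irreducible p \<Longrightarrow> c \<noteq> 0 \<Longrightarrow> P c \<Longrightarrow> P (p * c)"
  shows "P c"
  using assms(1)
proof (induction "total_degree c" arbitrary: c rule: less_induct)
  case less
  show ?case
  proof (cases "c dvd 1")
    case False
    with less.prems obtain p where p: "irreducible p" "p dvd c"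
      using irreducible_factor_exists by blast
    from p(2) obtain c' where c': "c = p * c'" by (rule dvdE)
    with less.prems have nz: "p \<noteq> 0" "c' \<noteq> 0" by auto
    have "\<not> p dvd 1" using p(1) unfolding irreducible_def by blast
    then have "total_degree c' < total_degree c"
      using total_degree_mult[OF nz] total_degree_eq_0_iff[OF nz(1)] c' by simp
    then have "P c'" using less.hyps nz(2) by blast
    then show ?thesis unfolding c' using mult p(1) nz(2) by blast
  qed (rule unit)
qed

text \<open>
  The irreducible factors of \<open>c\<close> are prime and, as \<open>A\<close> has a variable outside \<open>W\<close>, do not divide \<open>A\<close>;
  they are cancelled one by one.
\<close>

lemma cancel_lower_factor:
  fixes A c f :: "('v::linorder, 'a::differential_field) dpoly"
  assumes prime: "\<forall>p :: ('v, 'a) dpoly. irreducible p \<longrightarrow> dvars p \<subseteq> W \<longrightarrow> prime_over V p"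
    and A: "irreducible A" "\<not> dvars A \<subseteq> W" "dvars A \<subseteq> V"
    and c: "c \<noteq> 0" "dvars c \<subseteq> W" "W \<subseteq> V" and f: "dvars f \<subseteq> V"
    and dvd: "A dvd c * f"
  shows "A dvd f"
  using c(1,2) f dvd
proof (induction c arbitrary: f rule: irreducible_factor_induct)
  case (unit c)
  from unit(1) obtain d where d: "1 = c * d" by (rule dvdE)
  have "A dvd d * (c * f)" using unit.prems(3) by (rule dvd_mult)
  moreover have "d * (c * f) = (c * d) * f" by (simp only: ac_simps)
  ultimately show ?case by (simp only: d[symmetric] mult_1)
next
  case (mult p c)
  have nz: "p * c \<noteq> 0" using mult by auto
  then have W: "dvars p \<subseteq> W" "dvars c \<subseteq> W" using mult.prems(1) dvars_factor[OF nz] by auto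
  show ?case
  proof (cases "f = 0")
    case False
    from mult.prems(3) obtain w where w: "p * c * f = A * w" by (rule dvdE)
    have "p * c * f \<noteq> 0" using nz False by simp
    then have Aw: "A * w \<noteq> 0" using w by simp
    have "dvars (p * c * f) \<subseteq> V"
      using dvars_mult[of "p * c" f] mult.prems(1,2) c(3) by blast
    then have wV: "dvars w \<subseteq> V" using dvars_factor[OF Aw] w by simp
    have "p dvd A * w" using w by (metis dvd_triv_left mult.assoc)
    moreover have "\<not> p dvd A"
      using irreducible_not_dvd_if_more_vars[OF A(1,2) mult.hyps(1) W(1)] .
    ultimately have "p dvd w"
      using prime[rule_format, OF mult.hyps(1) W(1)] A(3) wV unfolding prime_over_def by blast
    then obtain w' where "w = p * w'" by (rule dvdE)
    with w have "p * (c * f) = p * (A * w')" by (simp add: ac_simps)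
    then have "c * f = A * w'" using nz by simp
    then have "A dvd c * f" by simp
    then show ?thesis using mult.IH W(2) mult.prems(2) by blast
  qed simp
qed

text \<open>
  Each irreducible factor of \<open>c\<close> divides \<open>q\<close> or \<open>h\<close> and can be removed there; what remains of \<open>q\<close> and
  \<open>h\<close> has product \<open>A\<close>.
\<close>

lemma distribute_lower_factor:
  fixes A c q h :: "('v::linorder, 'a::differential_field) dpoly"
  assumes prime: "\<forall>p :: ('v, 'a) dpoly. irreducible p \<longrightarrow> dvars p \<subseteq> W \<longrightarrow> prime_over V p"
    and c: "c \<noteq> 0" "dvars c \<subseteq> W" and qh: "dvars q \<subseteq> V" "dvars h \<subseteq> V" "q * h \<noteq> 0"
    and eq: "c * A = q * h"
  shows "\<exists>q' h' c'. A = q' * h' \<and> h = c' * h' \<and> dvars c' \<subseteq> W"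
  using c(1,2) qh eq
proof (induction c arbitrary: q h rule: irreducible_factor_induct)
  case (unit c)
  from unit(1) obtain d where d: "1 = c * d" by (rule dvdE)
  have "A = c * d * A" using d by simp
  also have "\<dots> = d * (c * A)" by (simp add: ac_simps)
  also have "\<dots> = d * q * h" using unit(6) by (simp add: ac_simps)
  finally show ?case by (intro exI[of _ "d * q"] exI[of _ h] exI[of _ 1]) simp
next
  case (mult p c)
  have nz: "p * c \<noteq> 0" using mult by auto
  then have W: "dvars p \<subseteq> W" "dvars c \<subseteq> W" using mult.prems(1) dvars_factor[OF nz] by auto
  have "p dvd q * h" using mult.prems(5) by (metis dvd_triv_left mult.assoc)
  then consider "p dvd q" | "p dvd h"
    using prime[rule_format, OF mult.hyps(1) W(1)] mult.prems(2,3) unfolding prime_over_def by blast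
  then show ?case
  proof cases
    case 1
    then obtain q1 where q1: "q = p * q1" by (rule dvdE)
    with mult.prems(5) nz have eq1: "c * A = q1 * h" by (simp add: mult.assoc)
    have "p * q1 \<noteq> 0" "q1 * h \<noteq> 0" using mult.prems(4) q1 by auto
    then have "dvars q1 \<subseteq> V" using dvars_factor[of p q1] mult.prems(2) q1 by simp
    then show ?thesis using mult.IH[OF W(2) _ mult.prems(3) \<open>q1 * h \<noteq> 0\<close> eq1] by blast
  next
    case 2
    then obtain h1 where h1: "h = p * h1" by (rule dvdE)
    with mult.prems(5) nz have eq1: "c * A = q * h1" by (simp add: mult.left_commute mult.assoc)
    have "p * h1 \<noteq> 0" "q * h1 \<noteq> 0" using mult.prems(4) h1 by auto
    then have "dvars h1 \<subseteq> V" using dvars_factor[of p h1] mult.prems(3) h1 by simp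
    then obtain q' h' c' where *: "A = q' * h'" "h1 = c' * h'" "dvars c' \<subseteq> W"
      using mult.IH[OF W(2) mult.prems(2) _ \<open>q * h1 \<noteq> 0\<close> eq1] by blast
    have "h = p * c' * h'" using h1 *(2) by (simp add: mult.assoc)
    moreover have "dvars (p * c') \<subseteq> W" using dvars_mult[of p c'] W(1) *(3) by blast
    ultimately show ?thesis using *(1) by blast
  qed
qed

text \<open>
  Among the \<open>h\<close> with \<open>A dvd h * g\<close> one of least degree in \<open>z\<close> divides all others up to factors free of
  \<open>z\<close>: a remainder would have smaller degree. If \<open>h\<close> itself is free of \<open>z\<close>, it cancels in \<open>A dvd h * g\<close>.
  Otherwise the division of \<open>A\<close> by \<open>h\<close> and irreducibility give \<open>A dvd h\<close>, and then the division of \<open>f\<close> by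
  \<open>h\<close> gives \<open>A dvd f\<close>.
\<close>

lemma prime_over_step:
  fixes A :: "('v::linorder, 'a::differential_field) dpoly"
  assumes prime: "\<forall>p :: ('v, 'a) dpoly. irreducible p \<longrightarrow> dvars p \<subseteq> W \<longrightarrow> prime_over (insert z W) p"
    and A: "irreducible A" "dvars A \<subseteq> insert z W" "z \<in> dvars A" and z: "z \<notin> W"
  shows "prime_over (insert z W) A"
  unfolding prime_over_def
proof (intro allI impI)
  let ?V = "insert z W"
  fix f g assume fV: "dvars f \<subseteq> ?V" and gV: "dvars g \<subseteq> ?V" and fg: "A dvd f * g"
  define J where "J = {h. dvars h \<subseteq> ?V \<and> A dvd h * g}"
  have A0: "A \<noteq> 0" using A(1) by (auto simp: irreducible_def)
  have "A \<in> J - {0}" using A A0 by (simp add: J_def)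
  then obtain h where h: "h \<in> J - {0}" and hmin: "\<And>k. k \<in> J - {0} \<Longrightarrow> var_degree z h \<le> var_degree z k"
    using ex_has_least_nat[of "\<lambda>h. h \<in> J - {0}" A "var_degree z"] by blast
  have h0: "h \<noteq> 0" and hV: "dvars h \<subseteq> ?V" and hg: "A dvd h * g" using h by (auto simp: J_def)
  let ?c = "lead_coeff (to_poly z h)"
  have cW: "dvars (?c ^ k) \<subseteq> W" for k
    using dvars_power[of ?c k] dvars_coeff_to_poly[of z h] hV by blast
  have c0: "?c ^ k \<noteq> 0" for k using h0 by simp
  have A_not: "\<not> dvars A \<subseteq> W" using A(3) z by blast
  note cancel = cancel_lower_factor[OF prime A(1) A_not A(2) _ _ subset_insertI]
  have multiple: "\<exists>k q. ?c ^ k * f0 = q * h" if "f0 \<in> J" for f0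
  proof -
    from that have f0: "dvars f0 \<subseteq> ?V" "A dvd f0 * g" by (auto simp: J_def)
    obtain k q r where kqr: "?c ^ k * f0 = q * h + r"
        "r = 0 \<or> var_degree z r < var_degree z h" "dvars r \<subseteq> ?V"
      using pseudo_division[OF h0 hV _ f0(1), of z] by blast
    have "r = ?c ^ k * f0 - q * h" using kqr(1) by simp
    then have "r * g = ?c ^ k * (f0 * g) - q * (h * g)"
      by (simp only: left_diff_distrib mult.assoc)
    then have "A dvd r * g" using f0(2) hg by (simp add: dvd_diff)
    with kqr(3) have "r \<in> J" by (simp add: J_def)
    with kqr(2) hmin[of r] have "r = 0" by force
    with kqr(1) show ?thesis by auto
  qed
  show "A dvd f \<or> A dvd g"
  proof (cases "z \<in> dvars h")
    case False
    then have "dvars h \<subseteq> W" using hV by blast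
    then show ?thesis using cancel[OF h0 _ gV hg] by blast
  next
    case True
    have "A \<in> J" using A by (simp add: J_def)
    then obtain k q where kq: "?c ^ k * A = q * h" using multiple by blast
    have "?c ^ k * A \<noteq> 0" using c0 A0 by simp
    then have qh0: "q * h \<noteq> 0" using kq by simp
    have "dvars (?c ^ k * A) \<subseteq> ?V"
      using dvars_mult[of "?c ^ k" A] cW[of k] A(2) by blast
    then have qV: "dvars q \<subseteq> ?V" using dvars_factor[OF qh0] kq by simp
    obtain q' h' c' where *: "A = q' * h'" "h = c' * h'" "dvars c' \<subseteq> W"
      using distribute_lower_factor[OF prime c0 cW qV hV qh0 kq] by blast
    have "z \<in> dvars h'" using True *(2,3) z dvars_mult[of c' h'] by blast
    then have "\<not> h' dvd 1" using dvd_1_dvars[of h'] by blast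
    with A(1) *(1) have "q' dvd 1" unfolding irreducible_def by blast
    then obtain d where d: "1 = q' * d" by (rule dvdE)
    have "h' = (q' * d) * h'" by (simp only: d[symmetric] mult_1)
    also have "\<dots> = A * d" by (simp only: *(1) ac_simps)
    finally have "A dvd h'" by (rule dvdI)
    with *(2) have Ah: "A dvd h" by simp
    have "f \<in> J" using fV fg by (simp add: J_def)
    then obtain k2 q2 where "?c ^ k2 * f = q2 * h" using multiple by blast
    with Ah have "A dvd ?c ^ k2 * f" by simp
    then show ?thesis using cancel[OF c0 cW fV] by blast
  qed
qed

lemma irreducible_imp_prime_over:
  fixes A :: "('v::linorder, 'a::differential_field) dpoly"
  assumes "finite V" "irreducible A" "dvars A \<subseteq> V"
  shows "prime_over V A"
  using assms
proof (induction V arbitrary: A rule: finite_induct)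
  case empty
  then obtain c where c: "A = dconst c" using dpoly_const_if_dvars_empty[of A] by blast
  from empty(1) have "A \<noteq> 0" "\<not> A dvd 1" by (auto simp: irreducible_def)
  then show ?case using c dconst_dvd_1[of c] by (cases "c = 0") auto
next
  case (insert z W)
  have prime: "\<forall>p :: ('v, 'a) dpoly. irreducible p \<longrightarrow> dvars p \<subseteq> W \<longrightarrow> prime_over (insert z W) p"
    using insert.IH insert.hyps(2) by (intro allI impI prime_over_insert) auto
  show ?case
  proof (cases "z \<in> dvars A")
    case True
    then show ?thesis using prime_over_step[OF prime insert.prems _ insert.hyps(2)] by blast
  qed (use insert.prems prime in blast)
qed

theorem irreducible_imp_prime_elem_dpoly:
  fixes A :: "('v::linorder, 'a::differential_field) dpoly"
  assumes "irreducible A"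
  shows "prime_elem A"
proof (rule prime_elemI)
  show "A \<noteq> 0" "\<not> A dvd 1" using assms by (auto simp: irreducible_def)
next
  fix f g assume "A dvd f * g"
  moreover have "prime_over (dvars A \<union> dvars f \<union> dvars g) A"
    using assms by (intro irreducible_imp_prime_over) auto
  ultimately show "A dvd f \<or> A dvd g" unfolding prime_over_def by blast
qed

text \<open>
  The irreducible factors of \<open>Q\<close> are prime and do not divide \<open>P\<close>, so one after the other they divide \<open>R\<close>.
\<close>

lemma coprime_dvd_mult_dpoly:
  fixes P Q R :: "('v::linorder, 'a::differential_field) dpoly"
  assumes "Q \<noteq> 0" "\<And>d. d dvd P \<Longrightarrow> d dvd Q \<Longrightarrow> d dvd 1" "Q dvd P * R"
  shows "Q dvd R"
  using assms
proof (induction Q arbitrary: R rule: irreducible_factor_induct)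
  case (unit Q)
  show ?case by (rule dvd_trans[OF unit(1) one_dvd])
next
  case (mult p Q)
  have p: "prime_elem p" by (rule irreducible_imp_prime_elem_dpoly[OF mult.hyps(1)])
  then have p0: "p \<noteq> 0" "\<not> p dvd 1" by (auto simp: prime_elem_def)
  have "p dvd p * Q" by simp
  then have "\<not> p dvd P" using mult.prems(1)[of p] p0(2) by blast
  moreover have "p dvd P * R" by (rule dvd_mult_left[OF mult.prems(2)])
  ultimately have "p dvd R" using prime_elem_dvd_multD[OF p] by blast
  then obtain R' where R': "R = p * R'" by (rule dvdE)
  from mult.prems(2) have "p * Q dvd p * (P * R')" unfolding R' by (simp add: mult.left_commute)
  then have "Q dvd P * R'" using p0 by simp
  have "d dvd 1" if "d dvd P" "d dvd Q" for d
    by (rule mult.prems(1)[OF that(1) dvd_mult[OF that(2)]])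
  then have "Q dvd R'" using \<open>Q dvd P * R'\<close> by (rule mult.IH)
  then show ?case unfolding R' by (simp add: mult_dvd_mono)
qed

section \<open>The differential ideal of a single polynomial\<close>

text \<open>
  The members of \<open>[B]\<close> that need only the first \<open>n\<close> of the generators \<open>B, B', B'', \<dots>\<close>; elimination
  proceeds by induction on \<open>n\<close>.
\<close>

definition ideal_below :: "('v, 'a::differential_field) dpoly \<Rightarrow> nat \<Rightarrow> ('v, 'a) dpoly set" where
  "ideal_below B n = {f. \<exists>g. f = (\<Sum>i<n. g i * (dpoly_der ^^ i) B)}"

lemma ideal_below_add:
  assumes "f \<in> ideal_below B n" "g \<in> ideal_below B n"
  shows "f + g \<in> ideal_below B n"
proof -
  from assms obtain a b where "f = (\<Sum>i<n. a i * (dpoly_der ^^ i) B)" "g = (\<Sum>i<n. b i * (dpoly_der ^^ i) B)"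
    by (auto simp: ideal_below_def)
  then have "f + g = (\<Sum>i<n. (a i + b i) * (dpoly_der ^^ i) B)"
    by (simp add: distrib_right sum.distrib)
  then show ?thesis unfolding ideal_below_def by (intro CollectI exI)
qed

lemma ideal_below_mult:
  assumes "f \<in> ideal_below B n"
  shows "r * f \<in> ideal_below B n"
proof -
  from assms obtain a where "f = (\<Sum>i<n. a i * (dpoly_der ^^ i) B)" by (auto simp: ideal_below_def)
  then have "r * f = (\<Sum>i<n. (r * a i) * (dpoly_der ^^ i) B)"
    by (simp add: sum_distrib_left mult.assoc)
  then show ?thesis unfolding ideal_below_def by (intro CollectI exI)
qed

lemma ideal_below_0: "0 \<in> ideal_below B n"
  unfolding ideal_below_def by (rule CollectI, rule exI[of _ "\<lambda>_. 0"]) simp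

lemma ideal_below_generator:
  assumes "i < n"
  shows "r * (dpoly_der ^^ i) B \<in> ideal_below B n"
proof -
  have "r * (dpoly_der ^^ i) B = (\<Sum>j<n. (if j = i then r else 0) * (dpoly_der ^^ j) B)"
    using assms by (simp add: if_distrib[of "\<lambda>x. x * _"] sum.delta cong: if_cong)
  then show ?thesis unfolding ideal_below_def by (intro CollectI exI)
qed

lemma ideal_below_sum: "(\<And>i. i \<in> I \<Longrightarrow> F i \<in> ideal_below B n) \<Longrightarrow> sum F I \<in> ideal_below B n"
  by (induction I rule: infinite_finite_induct) (auto intro: ideal_below_0 ideal_below_add)

lemma ideal_below_mono: "n \<le> m \<Longrightarrow> f \<in> ideal_below B n \<Longrightarrow> f \<in> ideal_below B m"
  by (auto simp: ideal_below_def[of B n] intro!: ideal_below_sum ideal_below_generator)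

lemma ideal_below_der:
  assumes "f \<in> ideal_below B n"
  shows "dpoly_der f \<in> ideal_below B (Suc n)"
proof -
  from assms obtain a where f: "f = (\<Sum>i<n. a i * (dpoly_der ^^ i) B)" by (auto simp: ideal_below_def)
  have "dpoly_der f = (\<Sum>i<n. dpoly_der (a i) * (dpoly_der ^^ i) B + a i * (dpoly_der ^^ Suc i) B)"
    unfolding f dpoly_der_sum dpoly_der_mult by simp
  then show ?thesis
    by (simp only:) (intro ideal_below_sum ideal_below_add ideal_below_generator, auto)
qed

lemma diff_ideal_gen_subset: "diff_ideal_gen B \<subseteq> (\<Union>n. ideal_below B n)"
proof -
  let ?J = "\<Union>n. ideal_below B n"
  have "B \<in> ideal_below B 1" using ideal_below_generator[of 0 1 1 B] by simp
  then have "B \<in> ?J" by blast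
  moreover have "differential_ideal UNIV ?J"
    unfolding differential_ideal_def
  proof (intro conjI ballI)
    fix f g assume "f \<in> ?J" "g \<in> ?J"
    then obtain n m where "f \<in> ideal_below B n" "g \<in> ideal_below B m" by blast
    then have "f + g \<in> ideal_below B (max n m)"
      by (intro ideal_below_add) (auto intro: ideal_below_mono[rotated])
    then show "f + g \<in> ?J" by blast
  next
    show "0 \<in> ?J" using ideal_below_0 by (rule UN_I[OF UNIV_I])
  next
    fix r f assume "f \<in> ?J"
    then obtain n where n: "f \<in> ideal_below B n" by blast
    show "r * f \<in> ?J" using ideal_below_mult[OF n] by (rule UN_I[OF UNIV_I])
    show "dpoly_der f \<in> ?J" using ideal_below_der[OF n] by (rule UN_I[OF UNIV_I])
  qed simp
  ultimately show ?thesis unfolding diff_ideal_gen_def by blast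
qed

lemma differential_ideal_diff_ideal_gen: "differential_ideal UNIV (diff_ideal_gen B)"
  unfolding diff_ideal_gen_def differential_ideal_def by blast

lemma diff_ideal_gen_generator: "B \<in> diff_ideal_gen B"
  unfolding diff_ideal_gen_def by blast

lemma diff_ideal_gen_add: "f \<in> diff_ideal_gen B \<Longrightarrow> g \<in> diff_ideal_gen B \<Longrightarrow> f + g \<in> diff_ideal_gen B"
  and diff_ideal_gen_mult: "f \<in> diff_ideal_gen B \<Longrightarrow> r * f \<in> diff_ideal_gen B"
  and diff_ideal_gen_der: "f \<in> diff_ideal_gen B \<Longrightarrow> dpoly_der f \<in> diff_ideal_gen B"
  and diff_ideal_gen_0: "0 \<in> diff_ideal_gen B"
  using differential_ideal_diff_ideal_gen[of B] unfolding differential_ideal_def by blast+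

text \<open>
  Modulo \<open>L\<close> the variable \<open>z\<close> equals \<open>- T / S\<close>; powers of \<open>S\<close> clear the denominators.
\<close>

lemma pseudo_reduce_linear:
  assumes "L = S * dvar z + T" "z \<notin> dvars S" "z \<notin> dvars T"
  shows "\<exists>N g'. z \<notin> dvars g' \<and> L dvd S ^ N * g - g'"
proof (induction g rule: dpoly_induct)
  case (const c)
  show ?case by (intro exI[of _ 0] exI[of _ "dconst c"]) simp
next
  case (var w)
  show ?case
  proof (cases "w = z")
    case True
    have "S ^ 1 * dvar w - (- T) = L" using True assms(1) by simp
    then show ?thesis using assms(3) by (intro exI[of _ 1] exI[of _ "- T"]) simp
  next
    case False
    then show ?thesis by (intro exI[of _ 0] exI[of _ "dvar w"]) auto
  qed
next
  case (add f g)
  then obtain M f' N g' where *: "z \<notin> dvars f'" "L dvd S ^ M * f - f'" "z \<notin> dvars g'" "L dvd S ^ N * g - g'"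
    by blast
  have "L dvd S ^ N * (S ^ M * f - f') + S ^ M * (S ^ N * g - g')"
    using *(2,4) by (intro dvd_add dvd_mult)
  also have "S ^ N * (S ^ M * f - f') + S ^ M * (S ^ N * g - g')
      = S ^ (M + N) * (f + g) - (S ^ N * f' + S ^ M * g')"
    by (simp add: power_add algebra_simps)
  finally have "L dvd S ^ (M + N) * (f + g) - (S ^ N * f' + S ^ M * g')" .
  moreover have "z \<notin> dvars (S ^ N * f' + S ^ M * g')"
    using *(1,3) assms(2) dvars_add[of "S ^ N * f'" "S ^ M * g'"] dvars_mult[of "S ^ N" f']
      dvars_mult[of "S ^ M" g'] dvars_power[of S N] dvars_power[of S M] by blast
  ultimately show ?case by blast
next
  case (mult f g)
  then obtain M f' N g' where *: "z \<notin> dvars f'" "L dvd S ^ M * f - f'" "z \<notin> dvars g'" "L dvd S ^ N * g - g'"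
    by blast
  have "L dvd (S ^ M * f - f') * (S ^ N * g) + f' * (S ^ N * g - g')"
    using *(2,4) by (intro dvd_add dvd_mult dvd_mult2)
  also have "(S ^ M * f - f') * (S ^ N * g) + f' * (S ^ N * g - g') = S ^ (M + N) * (f * g) - f' * g'"
    by (simp add: power_add algebra_simps)
  finally have "L dvd S ^ (M + N) * (f * g) - f' * g'" .
  moreover have "z \<notin> dvars (f' * g')" using *(1,3) dvars_mult[of f' g'] by blast
  ultimately show ?case by blast
qed

lemma pseudo_reduce_combination:
  fixes A :: "('v, 'a::differential_field) dpoly"
  assumes L: "L = S * dvar z + T" "z \<notin> dvars S" "z \<notin> dvars T"
    and free: "\<And>i. i < n \<Longrightarrow> z \<notin> dvars ((dpoly_der ^^ i) A)"
    and f: "f \<in> ideal_below A n"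
  shows "\<exists>N f'. f' \<in> ideal_below A n \<and> z \<notin> dvars f' \<and> L dvd S ^ N * f - f'"
proof -
  from f obtain a where f: "f = (\<Sum>i<n. a i * (dpoly_der ^^ i) A)" by (auto simp: ideal_below_def)
  have "\<exists>N f'. f' \<in> ideal_below A n \<and> z \<notin> dvars f' \<and> L dvd S ^ N * (\<Sum>i<k. a i * (dpoly_der ^^ i) A) - f'"
    if "k \<le> n" for k
    using that
  proof (induction k)
    case 0
    show ?case by (intro exI[of _ 0]) (auto intro: ideal_below_0)
  next
    case (Suc k)
    let ?s = "\<Sum>i<k. a i * (dpoly_der ^^ i) A" and ?A = "(dpoly_der ^^ k) A"
    from Suc obtain M f' where 1: "f' \<in> ideal_below A n" "z \<notin> dvars f'" "L dvd S ^ M * ?s - f'" by auto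
    obtain N g' where 2: "z \<notin> dvars g'" "L dvd S ^ N * a k - g'"
      using pseudo_reduce_linear[OF L] by blast
    let ?r = "S ^ N * f' + (S ^ M * g') * ?A"
    have "L dvd S ^ N * (S ^ M * ?s - f') + (S ^ M * ?A) * (S ^ N * a k - g')"
      using 1(3) 2(2) by (intro dvd_add dvd_mult)
    also have "S ^ N * (S ^ M * ?s - f') + (S ^ M * ?A) * (S ^ N * a k - g')
        = S ^ (M + N) * (\<Sum>i<Suc k. a i * (dpoly_der ^^ i) A) - ?r"
      by (simp add: power_add algebra_simps)
    finally have "L dvd S ^ (M + N) * (\<Sum>i<Suc k. a i * (dpoly_der ^^ i) A) - ?r" .
    moreover have "z \<notin> dvars ?A" using free[of k] Suc.prems by simp
    then have "z \<notin> dvars ?r"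
      using 1(2) 2(1) L(2) dvars_add[of "S ^ N * f'" "(S ^ M * g') * ?A"]
        dvars_mult[of "S ^ N" f'] dvars_mult[of "S ^ M * g'" ?A] dvars_mult[of "S ^ M" g']
        dvars_power[of S N] dvars_power[of S M] by blast
    moreover have "?r \<in> ideal_below A n"
      using Suc.prems by (intro ideal_below_add ideal_below_mult 1 ideal_below_generator) auto
    ultimately show ?case by blast
  qed
  from this[of n] f show ?thesis by simp
qed

text \<open>
  The highest generator \<open>L = A\<^sup>(\<^sup>M\<^sup>+\<^sup>1\<^sup>)\<close> is linear in \<open>z = w\<^sup>(\<^sup>q\<^sup>+\<^sup>M\<^sup>+\<^sup>1\<^sup>)\<close> with coefficient \<open>S\<close>, and neither
  \<open>h\<close> nor the lower generators contain \<open>z\<close>. Once \<open>z\<close> has been removed from the cofactors of the lower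
  generators, the cofactor of \<open>L\<close> must be zero, as its product with \<open>L\<close> is free of \<open>z\<close>. So \<open>L\<close> can be
  dropped, and at the end of the induction \<open>A\<close> is the only generator.
\<close>

lemma dvd_if_in_ideal_of_low_order:
  fixes A :: "('v::linorder, 'a::differential_field) dpoly"
  assumes top: "\<And>k. k > q \<Longrightarrow> (w, k) \<notin> dvars A"
    and S: "S = partial_deriv (w, q) A" "S \<noteq> 0"
    and h: "h \<in> ideal_below A (Suc M)" "\<And>k. k > q \<Longrightarrow> (w, k) \<notin> dvars h"
  shows "\<exists>N. A dvd S ^ N * h"
  using h
proof (induction M arbitrary: h)
  case 0
  then obtain g where "h = g * A" by (auto simp: ideal_below_def)
  then show ?case by (intro exI[of _ 0]) simp
next
  case (Suc M)
  let ?z = "(w, q + Suc M)"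
  define L where "L = (dpoly_der ^^ Suc M) A"
  define T where "T = L - S * dvar ?z"
  note order = higher_derivative_order[of q w A, OF top]
  have SA: "dvars S \<subseteq> dvars A" unfolding S(1) by (rule dvars_partial_deriv)
  have zS: "?z \<notin> dvars S" using SA top[of "q + Suc M"] by auto
  have Lz: "partial_deriv ?z L = S" using order[of "Suc M"] unfolding L_def S(1) by blast
  have "partial_deriv ?z T = 0"
    unfolding T_def partial_deriv_diff partial_deriv_mult Lz partial_deriv_var
      partial_deriv_eq_0_iff[THEN iffD2, OF zS] by simp
  then have zT: "?z \<notin> dvars T" by (simp only: partial_deriv_eq_0_iff not_False_eq_True)
  have L: "L = S * dvar ?z + T" unfolding T_def by simp
  have zfree: "?z \<notin> dvars ((dpoly_der ^^ i) A)" if "i < Suc M" for i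
    using order[of i] that by auto
  from Suc.prems(1) obtain a where a: "h = (\<Sum>i<Suc (Suc M). a i * (dpoly_der ^^ i) A)"
    by (auto simp: ideal_below_def)
  define f where "f = (\<Sum>i<Suc M. a i * (dpoly_der ^^ i) A)"
  have hf: "h = f + a (Suc M) * L" unfolding a f_def L_def by simp
  have "f \<in> ideal_below A (Suc M)" unfolding f_def ideal_below_def by blast
  then obtain N f' where f': "f' \<in> ideal_below A (Suc M)" "?z \<notin> dvars f'" "L dvd S ^ N * f - f'"
    using pseudo_reduce_combination[OF L zS zT zfree] by blast
  have "L dvd (S ^ N * f - f') + S ^ N * (a (Suc M) * L)" using f'(3) by (intro dvd_add) auto
  also have "(S ^ N * f - f') + S ^ N * (a (Suc M) * L) = S ^ N * h - f'"
    unfolding hf by (simp only: distrib_left diff_add_eq)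
  finally obtain G where G: "S ^ N * h - f' = L * G" by (rule dvdE)
  have "?z \<notin> dvars (S ^ N * h - f')"
    using dvars_diff[of "S ^ N * h" f'] dvars_mult[of "S ^ N" h] dvars_power[of S N] zS f'(2)
      Suc.prems(2)[of "q + Suc M"] by auto
  moreover have "?z \<in> dvars L" using Lz S(2) partial_deriv_eq_0_iff by metis
  ultimately have "L * G = 0" using dvars_factor[of L G] unfolding G by blast
  with G have "S ^ N * h - f' = 0" by (rule trans)
  then have "S ^ N * h = f'" by (rule eq_iff_diff_eq_0[THEN iffD2])
  then have "S ^ N * h \<in> ideal_below A (Suc M)" using f'(1) by simp
  moreover have "(w, k) \<notin> dvars (S ^ N * h)" if "k > q" for k
    using dvars_mult[of "S ^ N" h] dvars_power[of S N] SA top[OF that] Suc.prems(2)[OF that] by blast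
  ultimately obtain N' where "A dvd S ^ N' * (S ^ N * h)" using Suc.IH by blast
  then have "A dvd S ^ (N' + N) * h" by (simp add: power_add mult.assoc)
  then show ?case by blast
qed

lemma to_poly_partial_deriv: "to_poly z (partial_deriv z f) = pderiv (to_poly z f)"
proof (induction f rule: dpoly_induct)
  case (add f g)
  then show ?case by (simp add: partial_deriv_add to_poly_add pderiv_add)
next
  case (mult f g)
  then show ?case by (simp add: partial_deriv_mult to_poly_add to_poly_mult pderiv_mult algebra_simps)
qed (auto simp: to_poly_var partial_deriv_var pderiv_pCons)

lemma not_dvd_partial_deriv:
  fixes A :: "('v::linorder, 'a::differential_field) dpoly"
  assumes "partial_deriv z A \<noteq> 0"
  shows "\<not> A dvd partial_deriv z A"
proof
  assume "A dvd partial_deriv z A"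
  then obtain g where g: "partial_deriv z A = A * g" by (rule dvdE)
  with assms have nz: "A \<noteq> 0" "g \<noteq> 0" by auto
  have "z \<in> dvars A" using assms partial_deriv_eq_0_iff by blast
  then have "var_degree z A \<noteq> 0" by (simp add: var_degree_eq_0_iff)
  moreover have "var_degree z (partial_deriv z A) = var_degree z A - 1"
    unfolding var_degree_def to_poly_partial_deriv by (rule degree_pderiv)
  ultimately show False using var_degree_mult[OF nz, of z] g by simp
qed

text \<open>
  The product does not contain derivatives of \<open>w\<close> beyond \<open>q\<close>. If it were in \<open>[A]\<close>, then \<open>A\<close> would divide it
  up to a power of \<open>\<partial>A/\<partial>w\<^sup>(\<^sup>q\<^sup>)\<close>, although a prime \<open>A\<close> divides no product of its nonzero partial
  derivatives. With the leader as \<open>l\<close> this says that the saturation does not contain \<open>\<partial>A/\<partial>w\<^sup>(\<^sup>q\<^sup>)\<close>.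
\<close>

lemma partial_deriv_not_in_saturation:
  fixes A :: "('v::linorder, 'a::differential_field) dpoly"
  assumes A: "irreducible A" and w: "(w, q) \<in> dvars A" "\<And>k. k > q \<Longrightarrow> (w, k) \<notin> dvars A"
    and l: "partial_deriv l A \<noteq> 0"
  shows "partial_deriv l A ^ m * partial_deriv (w, q) A \<notin> diff_ideal_gen A"
proof
  define S where "S = partial_deriv (w, q) A"
  define h where "h = partial_deriv l A ^ m * S"
  have S0: "S \<noteq> 0" using w(1) unfolding S_def partial_deriv_eq_0_iff by simp
  assume "partial_deriv l A ^ m * partial_deriv (w, q) A \<in> diff_ideal_gen A"
  then obtain n where "h \<in> ideal_below A n" using diff_ideal_gen_subset[of A] unfolding h_def S_def by blast
  then have h: "h \<in> ideal_below A (Suc n)" by (rule ideal_below_mono[rotated]) simp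
  have "dvars h \<subseteq> dvars A"
    using dvars_mult[of "partial_deriv l A ^ m" S] dvars_power[of "partial_deriv l A" m]
      dvars_partial_deriv[of l A] dvars_partial_deriv[of "(w, q)" A] unfolding h_def S_def by blast
  then obtain N where "A dvd S ^ N * h"
    using dvd_if_in_ideal_of_low_order[OF w(2) S_def S0 h] w(2) by blast
  then have "A dvd S ^ N * (partial_deriv l A ^ m * S)" unfolding h_def .
  moreover have p: "prime_elem A" by (rule irreducible_imp_prime_elem_dpoly[OF A])
  ultimately have "A dvd S ^ N \<or> A dvd partial_deriv l A ^ m \<or> A dvd S"
    by (simp only: prime_elem_dvd_mult_iff)
  then have "A dvd S \<or> A dvd partial_deriv l A"
    using prime_elem_dvd_power[OF p, of S N] prime_elem_dvd_power[OF p, of "partial_deriv l A" m] by argo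
  moreover have "\<not> A dvd S" unfolding S_def by (rule not_dvd_partial_deriv[OF S0[unfolded S_def]])
  ultimately show False using not_dvd_partial_deriv[OF l] by argo
qed

section \<open>Linear algebra\<close>

lemma homogeneous_system_nontrivial:
  fixes M :: "'i \<Rightarrow> nat \<Rightarrow> 'e::field"
  assumes "finite I" "t < card I"
  shows "\<exists>c. (\<exists>i\<in>I. c i \<noteq> 0) \<and> (\<forall>j<t. (\<Sum>i\<in>I. c i * M i j) = 0)"
  using assms
proof (induction t arbitrary: I M)
  case 0
  then have "I \<noteq> {}" by auto
  then show ?case by (intro exI[of _ "\<lambda>_. 1"]) auto
next
  case (Suc t)
  show ?case
  proof (cases "\<exists>i\<in>I. M i t \<noteq> 0")
    case False
    have "t < card I" using Suc.prems by simp
    then obtain c where "\<exists>i\<in>I. c i \<noteq> 0" "\<forall>j<t. (\<Sum>i\<in>I. c i * M i j) = 0"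
      using Suc.IH[OF Suc.prems(1), of M] by blast
    moreover have "(\<Sum>i\<in>I. c i * M i t) = 0" using False by (intro sum.neutral) auto
    ultimately show ?thesis by (intro exI[of _ c]) (auto simp: less_Suc_eq)
  next
    case True
    then obtain k where k: "k \<in> I" "M k t \<noteq> 0" by blast
    define I' where "I' = I - {k}"
    \<comment> \<open>Equation \<open>t\<close> is solved for the unknown \<open>k\<close>; \<open>R\<close> is the system that remains for the others.\<close>
    define R where "R i j = M i j - M i t / M k t * M k j" for i j
    have "finite I'" "t < card I'" using Suc.prems k(1) unfolding I'_def by auto
    then obtain c where c: "\<exists>i\<in>I'. c i \<noteq> 0" "\<And>j. j < t \<Longrightarrow> (\<Sum>i\<in>I'. c i * R i j) = 0"
      using Suc.IH[of I' R] by blast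
    define d where "d i = (if i = k then - (\<Sum>i\<in>I'. c i * M i t) / M k t else c i)" for i
    have "(\<Sum>i\<in>I. d i * M i j) = (\<Sum>i\<in>I'. c i * R i j)" for j
    proof -
      have "(\<Sum>i\<in>I. d i * M i j) = d k * M k j + (\<Sum>i\<in>I'. d i * M i j)"
        using sum.remove[OF Suc.prems(1) k(1), of "\<lambda>i. d i * M i j"] by (simp only: I'_def)
      also have "(\<Sum>i\<in>I'. d i * M i j) = (\<Sum>i\<in>I'. c i * M i j)"
        by (rule sum.cong) (auto simp: d_def I'_def)
      also have "d k * M k j = - (\<Sum>i\<in>I'. c i * (M i t / M k t * M k j))"
      proof -
        have "(\<Sum>i\<in>I'. c i * M i t) / M k t * M k j = (\<Sum>i\<in>I'. c i * (M i t / M k t * M k j))"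
          unfolding sum_divide_distrib sum_distrib_right by (rule sum.cong) simp_all
        then show ?thesis by (simp only: d_def if_True refl minus_divide_left[symmetric] mult_minus_left)
      qed
      finally show ?thesis by (simp add: R_def right_diff_distrib sum_subtractf)
    qed
    moreover have "(\<Sum>i\<in>I'. c i * R i t) = 0" using k(2) by (simp add: R_def)
    ultimately have "\<forall>j<Suc t. (\<Sum>i\<in>I. d i * M i j) = 0" using c(2) by (auto simp: less_Suc_eq)
    moreover have "\<exists>i\<in>I. d i \<noteq> 0" using c(1) by (auto simp: d_def I'_def)
    ultimately show ?thesis by blast
  qed
qed

text \<open>
  A linear space that attains arbitrary values at \<open>m\<close> points has dimension at least \<open>m\<close>, and one whose
  members are determined by their values at \<open>t\<close> points has dimension at most \<open>t\<close>.
\<close>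

lemma interpolation_le_determination:
  fixes V :: "('x \<Rightarrow> 'e::field) set" and P Q :: "nat \<Rightarrow> 'x"
  assumes lin: "\<And>f c. (\<And>i. i < m \<Longrightarrow> f i \<in> V) \<Longrightarrow> (\<lambda>x. \<Sum>i<m. c i * f i x) \<in> V"
    and interpolate: "\<And>c. \<exists>f\<in>V. \<forall>i<m. f (P i) = c i"
    and determine: "\<And>f i. f \<in> V \<Longrightarrow> \<forall>j<t. f (Q j) = 0 \<Longrightarrow> f (P i) = 0"
  shows "m \<le> t"
proof (rule ccontr)
  assume "\<not> m \<le> t"
  have "\<forall>k. \<exists>f\<in>V. \<forall>i<m. f (P i) = (if i = k then 1 else 0)" by (intro allI interpolate)
  then obtain F where F: "\<And>k. F k \<in> V" "\<And>k i. i < m \<Longrightarrow> F k (P i) = (if i = k then 1 else 0)"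
    by metis
  obtain c where c: "\<exists>i<m. c i \<noteq> 0" "\<forall>j<t. (\<Sum>i<m. c i * F i (Q j)) = 0"
    using homogeneous_system_nontrivial[of "{..<m}" t "\<lambda>i j. F i (Q j)"] \<open>\<not> m \<le> t\<close> by auto
  from c(1) obtain k where k: "k < m" "c k \<noteq> 0" by blast
  let ?f = "\<lambda>x. \<Sum>i<m. c i * F i x"
  have "?f \<in> V" using F(1) by (intro lin)
  then have "?f (P k) = 0" using c(2) by (rule determine)
  moreover have "?f (P k) = c k"
    using k(1) by (simp add: F(2) if_distrib[of "\<lambda>x. _ * x"] sum.delta cong: if_cong)
  ultimately show False using k(2) by simp
qed

text \<open>
  Forward substitution: the equation with index \<open>k - r\<close> is solved for its last unknown, the one with index
  \<open>k\<close>.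
\<close>

function triangular_solution ::
    "nat \<Rightarrow> (nat \<Rightarrow> 'e::field) \<Rightarrow> (nat \<Rightarrow> nat \<Rightarrow> 'e) \<Rightarrow> nat \<Rightarrow> 'e" where
  "triangular_solution r c M k =
     (if k < r then c k else - (\<Sum>j<k. M (k - r) j * triangular_solution r c M j) / M (k - r) k)"
  by pat_completeness auto
termination by (relation "measure (\<lambda>(r, c, M, k). k)") auto

declare triangular_solution.simps [simp del]

lemma triangular_system_solvable:
  fixes M :: "nat \<Rightarrow> nat \<Rightarrow> 'e::field"
  assumes "\<And>i. M i (r + i) \<noteq> 0"
  shows "\<exists>\<eta>. (\<forall>j<r. \<eta> j = c j) \<and> (\<forall>i. (\<Sum>j\<le>r + i. M i j * \<eta> j) = 0)"
proof (rule exI[of _ "triangular_solution r c M"], intro conjI allI impI)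
  let ?\<eta> = "triangular_solution r c M"
  fix j assume "j < r"
  then show "?\<eta> j = c j" by (subst triangular_solution.simps) simp
next
  let ?\<eta> = "triangular_solution r c M"
  fix i
  have "?\<eta> (r + i) = - (\<Sum>j<r + i. M i j * ?\<eta> j) / M i (r + i)"
    by (subst triangular_solution.simps) simp
  then have "M i (r + i) * ?\<eta> (r + i) = - (\<Sum>j<r + i. M i j * ?\<eta> j)"
    using assms[of i] by (simp only: nonzero_mult_div_cancel_left times_divide_eq_right not_False_eq_True)
  moreover have "(\<Sum>j\<le>r + i. M i j * ?\<eta> j)
      = (\<Sum>j<r + i. M i j * ?\<eta> j) + M i (r + i) * ?\<eta> (r + i)"
    by (simp only: lessThan_Suc_atMost[symmetric] sum.lessThan_Suc)
  ultimately show "(\<Sum>j\<le>r + i. M i j * ?\<eta> j) = 0" by simp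
qed

section \<open>Derivations of a finitely generated differential field\<close>

lemma differential_subfield_diff_field_gen: "differential_subfield (diff_field_gen \<iota> S)"
  unfolding diff_field_gen_def differential_subfield_def by blast

lemma diff_field_gen_base: "\<iota> c \<in> diff_field_gen \<iota> S"
  and diff_field_gen_gen: "x \<in> S \<Longrightarrow> x \<in> diff_field_gen \<iota> S"
  unfolding diff_field_gen_def by auto

lemma diff_field_gen_least:
  "differential_subfield K \<Longrightarrow> range \<iota> \<subseteq> K \<Longrightarrow> S \<subseteq> K \<Longrightarrow> diff_field_gen \<iota> S \<subseteq> K"
  unfolding diff_field_gen_def by auto

lemma
  shows diff_field_gen_add: "x \<in> diff_field_gen \<iota> S \<Longrightarrow> y \<in> diff_field_gen \<iota> S \<Longrightarrow> x + y \<in> diff_field_gen \<iota> S"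
    and diff_field_gen_mult: "x \<in> diff_field_gen \<iota> S \<Longrightarrow> y \<in> diff_field_gen \<iota> S \<Longrightarrow> x * y \<in> diff_field_gen \<iota> S"
    and diff_field_gen_der: "x \<in> diff_field_gen \<iota> S \<Longrightarrow> der x \<in> diff_field_gen \<iota> S"
  using differential_subfield_diff_field_gen[of \<iota> S] unfolding differential_subfield_def by blast+

lemma diff_field_gen_higher_der: "x \<in> diff_field_gen \<iota> S \<Longrightarrow> (der ^^ k) x \<in> diff_field_gen \<iota> S"
  by (induction k) (auto intro: diff_field_gen_der)

lemma der_divide:
  fixes x y :: "'e::differential_field"
  assumes "y \<noteq> 0"
  shows "der (x / y) = (der x * y - x * der y) / (y * y)"
proof -
  have "der x = der (x / y) * y + x / y * der y"
    using assms der_mult[of "x / y" y] by simp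
  then have "der (x / y) * (y * y) = der x * y - x * der y"
    using assms by (simp add: algebra_simps)
  then show ?thesis using assms by (simp add: eq_divide_eq)
qed

text \<open>
  Values are taken in the ambient field rather than in \<open>L\<close>, so that the scalars of the space of derivations
  form a type.
\<close>

definition derivation_over ::
    "('f::differential_field \<Rightarrow> 'e::differential_field) \<Rightarrow> 'e set \<Rightarrow> ('e \<Rightarrow> 'e) \<Rightarrow> bool" where
  "derivation_over \<iota> L \<Delta> \<longleftrightarrow>
     (\<forall>x\<in>L. \<forall>y\<in>L. \<Delta> (x + y) = \<Delta> x + \<Delta> y) \<and>
     (\<forall>x\<in>L. \<forall>y\<in>L. \<Delta> (x * y) = \<Delta> x * y + x * \<Delta> y) \<and>
     (\<forall>c. \<Delta> (\<iota> c) = 0)"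

lemma derivation_over_linear_combination:
  assumes "\<And>i. i < m \<Longrightarrow> derivation_over \<iota> L (f i)"
  shows "derivation_over \<iota> L (\<lambda>x. \<Sum>i<m. c i * f i x)"
  using assms unfolding derivation_over_def
  by (auto simp: sum.distrib sum_distrib_left sum_distrib_right algebra_simps)

context diff_hom
begin

abbreviation ev :: "('v \<Rightarrow> 'e) \<Rightarrow> ('v, 'a) dpoly \<Rightarrow> 'e" where
  "ev p \<equiv> poly_eval \<iota> (jet p)"

lemma jet_in_diff_field_gen: "jet p w \<in> diff_field_gen \<iota> (range p)"
  unfolding jet_def by (intro diff_field_gen_higher_der diff_field_gen_gen) simp

lemma ev_in_diff_field_gen: "ev p f \<in> diff_field_gen \<iota> (range p)"
  by (induction f rule: dpoly_induct)
    (auto simp: poly_eval_add poly_eval_mult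
      intro: diff_field_gen_base jet_in_diff_field_gen diff_field_gen_add diff_field_gen_mult)

lemma diff_field_gen_range_fraction:
  assumes "x \<in> diff_field_gen \<iota> (range p)"
  shows "\<exists>f g. ev p g \<noteq> 0 \<and> x = ev p f / ev p g"
proof -
  let ?K = "{ev p f / ev p g | f g. ev p g \<noteq> 0}"
  have K: "ev p f / ev p g \<in> ?K" if "ev p g \<noteq> 0" for f g using that by blast
  have K1: "ev p f \<in> ?K" for f using K[of 1 f] by simp
  have "differential_subfield ?K"
    unfolding differential_subfield_def
  proof (intro conjI ballI)
    show "0 \<in> ?K" "1 \<in> ?K" using K1[of 0] K1[of 1] by simp_all
  next
    fix a b assume "a \<in> ?K" "b \<in> ?K"
    then obtain f g f' g' where *: "a = ev p f / ev p g" "ev p g \<noteq> 0" "b = ev p f' / ev p g'" "ev p g' \<noteq> 0"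
      by blast
    have "a + b = ev p (f * g' + f' * g) / ev p (g * g')"
      using * by (simp add: poly_eval_add poly_eval_mult add_frac_eq)
    then show "a + b \<in> ?K" by (rule ssubst) (rule K, simp add: poly_eval_mult *)
    have "a * b = ev p (f * f') / ev p (g * g')" using * by (simp add: poly_eval_mult)
    then show "a * b \<in> ?K" by (rule ssubst) (rule K, simp add: poly_eval_mult *)
  next
    fix a assume "a \<in> ?K"
    then obtain f g where *: "a = ev p f / ev p g" "ev p g \<noteq> 0" by blast
    show "- a \<in> ?K" using * K[of g "- f"] by (simp add: poly_eval_minus)
    show "inverse a \<in> ?K"
    proof (cases "ev p f = 0")
      case True
      then show ?thesis using * K1[of 0] by simp
    next
      case False
      then show ?thesis using * K[of f g] by simp
    qed
    have "der a = ev p (dpoly_der f * g - f * dpoly_der g) / ev p (g * g)"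
      unfolding *(1) der_divide[OF *(2)] by (simp add: poly_eval_mult poly_eval_diff poly_eval_dpoly_der)
    then show "der a \<in> ?K" using * K[of "g * g"] by (simp add: poly_eval_mult)
  qed
  moreover have "range \<iota> \<subseteq> ?K"
  proof
    fix y assume "y \<in> range \<iota>"
    then obtain c where "y = \<iota> c" by blast
    then have "y = ev p (dconst c)" by simp
    then show "y \<in> ?K" by (rule ssubst) (rule K1)
  qed
  moreover have "range p \<subseteq> ?K"
  proof
    fix y assume "y \<in> range p"
    then obtain v where "y = p v" by blast
    then have "y = ev p (dvar (v, 0))" by (simp add: jet_def)
    then show "y \<in> ?K" by (rule ssubst) (rule K1)
  qed
  ultimately have "diff_field_gen \<iota> (range p) \<subseteq> ?K" by (rule diff_field_gen_least)
  with assms show ?thesis by blast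
qed

lemma derivation_chain_rule:
  assumes "derivation_over \<iota> (diff_field_gen \<iota> (range p)) \<Delta>"
  shows "\<Delta> (ev p f) = dir_deriv \<iota> (jet p) (\<lambda>w. \<Delta> (jet p w)) f"
  using assms ev_in_diff_field_gen[of p]
  by (induction f rule: dpoly_induct)
    (auto simp: derivation_over_def poly_eval_add poly_eval_mult dir_deriv_add dir_deriv_mult)

lemma derivation_eq_0_if_jet_eq_0:
  assumes \<Delta>: "derivation_over \<iota> (diff_field_gen \<iota> (range p)) \<Delta>"
    and jet: "\<And>w. \<Delta> (jet p w) = 0" and x: "x \<in> diff_field_gen \<iota> (range p)"
  shows "\<Delta> x = 0"
proof -
  obtain f g where fg: "ev p g \<noteq> 0" "x = ev p f / ev p g"
    using diff_field_gen_range_fraction[OF x] by blast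
  have 0: "\<Delta> (ev p k) = 0" for k
    unfolding derivation_chain_rule[OF \<Delta>] by (simp add: dir_deriv_def jet)
  have "\<Delta> (x * ev p g) = \<Delta> x * ev p g + x * \<Delta> (ev p g)"
    using \<Delta> x ev_in_diff_field_gen[of p g] unfolding derivation_over_def by blast
  moreover have "x * ev p g = ev p f" using fg by simp
  ultimately show ?thesis using fg(1) by (simp add: 0)
qed

text \<open>
  A tangent vector that annihilates all relations of \<open>p\<close> is well defined on the values \<open>f(p)\<close>, and the
  quotient rule extends it to their fractions.
\<close>

lemma derivation_extension:
  assumes vanish: "\<And>f. ev p f = 0 \<Longrightarrow> dir_deriv \<iota> (jet p) \<xi> f = 0"
  shows "\<exists>\<Delta>. derivation_over \<iota> (diff_field_gen \<iota> (range p)) \<Delta> \<and> (\<forall>w. \<Delta> (jet p w) = \<xi> w)"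
proof -
  let ?D = "dir_deriv \<iota> (jet p) \<xi>"
  \<comment> \<open>The quotient rule for \<open>x = f/g\<close>, written as \<open>(\<Delta>f - x \<Delta>g) / g\<close>.\<close>
  define q where "q x f g = (?D f - x * ?D g) / ev p g" for x f g
  define rep where "rep x fg \<longleftrightarrow> ev p (snd fg) \<noteq> 0 \<and> x = ev p (fst fg) / ev p (snd fg)" for x fg
  define \<Delta> where "\<Delta> x = (let fg = SOME fg. rep x fg in q x (fst fg) (snd fg))" for x
  have unique: "q x f g = q x f' g'"
    if "ev p g \<noteq> 0" "ev p g' \<noteq> 0" "x * ev p g = ev p f" "x * ev p g' = ev p f'" for x f g f' g'
  proof -
    have "ev p (f * g' - f' * g) = 0"
      unfolding poly_eval_diff poly_eval_mult that(3,4)[symmetric] by (simp add: ac_simps)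
    then have "?D (f * g' - f' * g) = 0" by (rule vanish)
    then have "(?D f - x * ?D g) * ev p g' = (?D f' - x * ?D g') * ev p g"
      unfolding dir_deriv_diff dir_deriv_mult that(3,4)[symmetric] by (simp add: algebra_simps)
    then show ?thesis using that(1,2) unfolding q_def by (simp add: frac_eq_eq)
  qed
  have \<Delta>: "\<Delta> x = q x f g" if "ev p g \<noteq> 0" "x * ev p g = ev p f" for x f g
  proof -
    have "rep x (f, g)" using that unfolding rep_def by (simp add: field_simps)
    then have "rep x (SOME fg. rep x fg)" by (rule someI)
    moreover obtain f' g' where fg': "(SOME fg. rep x fg) = (f', g')" by (rule prod.exhaust)
    ultimately have "rep x (f', g')" by simp
    then have "ev p g' \<noteq> 0" "x * ev p g' = ev p f'" unfolding rep_def by auto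
    then have "q x f' g' = q x f g" using that by (intro unique)
    then show ?thesis unfolding \<Delta>_def Let_def fg' by simp
  qed
  have \<Delta>1: "\<Delta> (ev p f) = ?D f" for f using \<Delta>[of 1 "ev p f" f] by (simp add: q_def)
  have "derivation_over \<iota> (diff_field_gen \<iota> (range p)) \<Delta>"
    unfolding derivation_over_def
  proof (intro conjI ballI allI)
    fix x y assume "x \<in> diff_field_gen \<iota> (range p)" "y \<in> diff_field_gen \<iota> (range p)"
    then obtain f g f' g' where "ev p g \<noteq> 0" "x = ev p f / ev p g" "ev p g' \<noteq> 0" "y = ev p f' / ev p g'"
      using diff_field_gen_range_fraction by metis
    then have nz: "ev p g \<noteq> 0" "ev p g' \<noteq> 0" and eq: "x * ev p g = ev p f" "y * ev p g' = ev p f'"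
      by simp_all
    have nz': "ev p (g * g') \<noteq> 0" using nz by (simp add: poly_eval_mult)
    have x: "\<Delta> x = q x f g" and y: "\<Delta> y = q y f' g'" using \<Delta> nz eq by blast+
    have "(x + y) * ev p (g * g') = ev p (f * g' + f' * g)"
      unfolding poly_eval_add poly_eval_mult eq[symmetric] by (simp add: algebra_simps)
    from \<Delta>[OF nz' this] have "\<Delta> (x + y) = q (x + y) (f * g' + f' * g) (g * g')" .
    also have "\<dots> = ((?D f - x * ?D g) * ev p g' + (?D f' - y * ?D g') * ev p g) / (ev p g * ev p g')"
      unfolding q_def dir_deriv_add dir_deriv_mult poly_eval_mult eq[symmetric]
      by (simp add: algebra_simps)
    also have "\<dots> = \<Delta> x + \<Delta> y"
      unfolding x y q_def using nz by (simp add: add_frac_eq)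
    finally show "\<Delta> (x + y) = \<Delta> x + \<Delta> y" .
    have "(x * y) * ev p (g * g') = ev p (f * f')"
      unfolding poly_eval_mult eq[symmetric] by (simp add: algebra_simps)
    from \<Delta>[OF nz' this] have "\<Delta> (x * y) = q (x * y) (f * f') (g * g')" .
    also have "\<dots> = ((?D f - x * ?D g) * y * ev p g' + x * (?D f' - y * ?D g') * ev p g) / (ev p g * ev p g')"
      unfolding q_def dir_deriv_mult poly_eval_mult eq[symmetric]
      by (simp add: algebra_simps)
    also have "\<dots> = \<Delta> x * y + x * \<Delta> y"
      unfolding x y q_def using nz by (simp add: add_frac_eq)
    finally show "\<Delta> (x * y) = \<Delta> x * y + x * \<Delta> y" .
  next
    fix c show "\<Delta> (\<iota> c) = 0" using \<Delta>1[of "dconst c"] by simp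
  qed
  moreover have "\<Delta> (jet p w) = \<xi> w" for w using \<Delta>1[of "dvar w"] by simp
  ultimately show ?thesis by blast
qed

lemma ev_ideal_below:
  assumes "ev p B = 0" "f \<in> ideal_below B n"
  shows "ev p f = 0"
proof -
  have "ev p ((dpoly_der ^^ i) B) = 0" for i
    by (simp add: poly_eval_higher_derivative assms(1))
  then show ?thesis using assms(2) by (auto simp: ideal_below_def poly_eval_sum poly_eval_mult)
qed

text \<open>
  In the equation \<open>\<Delta>(B\<^sup>(\<^sup>i\<^sup>)(p)) = 0\<close> the coefficient of \<open>\<Delta>(w\<^sup>(\<^sup>r\<^sup>+\<^sup>i\<^sup>))\<close> is the nonzero value of
  \<open>\<partial>B/\<partial>w\<^sup>(\<^sup>r\<^sup>)\<close>, and all other terms vanish by induction or by the hypothesis on the other indeterminates.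
\<close>

lemma derivation_determined_by_equation:
  assumes \<Delta>: "derivation_over \<iota> (diff_field_gen \<iota> (range p)) \<Delta>"
    and top: "\<And>k. k > r \<Longrightarrow> (w, k) \<notin> dvars B"
    and zero: "ev p B = 0" and S: "ev p (partial_deriv (w, r) B) \<noteq> 0"
    and other: "\<And>v. v \<noteq> w \<Longrightarrow> (\<forall>k. \<Delta> (jet p (v, k)) = 0) \<or> (\<forall>k. (v, k) \<notin> dvars B)"
    and init: "\<And>j. j < r \<Longrightarrow> \<Delta> (jet p (w, j)) = 0"
  shows "\<Delta> (jet p (w, j)) = 0"
proof (induction j rule: less_induct)
  case (less j)
  show ?case
  proof (cases "j < r")
    case False
    then obtain i where j: "j = r + i" using le_Suc_ex not_less by blast
    define Bi where "Bi = (dpoly_der ^^ i) B"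
    have order: "(w, k) \<notin> dvars Bi" if "k > j" for k
      using higher_derivative_order[of r w B i, OF top] that unfolding Bi_def j by blast
    have Sj: "partial_deriv (w, j) Bi = partial_deriv (w, r) B"
      using higher_derivative_order[of r w B i, OF top] unfolding Bi_def j by blast
    have rest: "\<Delta> (jet p x) = 0" if "x \<in> dvars Bi - {(w, j)}" for x
    proof (cases "fst x = w")
      case True
      then obtain k where x: "x = (w, k)" by (cases x) auto
      have "k \<noteq> j" using that x by auto
      moreover have "\<not> k > j" using order[of k] that x by auto
      ultimately have "k < j" by linarith
      then show ?thesis using less x by simp
    next
      case False
      then show ?thesis using other[of "fst x"] higher_derivative_avoids[of "fst x" B "snd x" i] that
        unfolding Bi_def by (cases x) auto
    qed
    have "ev p Bi = \<iota> 0" unfolding Bi_def by (simp add: poly_eval_higher_derivative zero)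
    then have "\<Delta> (ev p Bi) = 0" using \<Delta> unfolding derivation_over_def by metis
    then have "0 = dir_deriv \<iota> (jet p) (\<lambda>x. \<Delta> (jet p x)) Bi"
      unfolding derivation_chain_rule[OF \<Delta>] by simp
    also have "\<dots> = (\<Sum>x\<in>insert (w, j) (dvars Bi). ev p (partial_deriv x Bi) * \<Delta> (jet p x))"
      by (rule dir_deriv_superset) auto
    also have "\<dots> = ev p (partial_deriv (w, j) Bi) * \<Delta> (jet p (w, j))
        + (\<Sum>x\<in>dvars Bi - {(w, j)}. ev p (partial_deriv x Bi) * \<Delta> (jet p x))"
      by (rule sum.insert_remove) simp
    also have "(\<Sum>x\<in>dvars Bi - {(w, j)}. ev p (partial_deriv x Bi) * \<Delta> (jet p x)) = 0"
      using rest by (intro sum.neutral ballI) simp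
    finally show ?thesis using S Sj by simp
  qed (rule init)
qed

text \<open>
  Given the first \<open>r\<close> values, the equations \<open>\<Delta>(B\<^sup>(\<^sup>i\<^sup>)(p)) = 0\<close> form a triangular system for the others. Its
  solution annihilates the generators of \<open>[B]\<close>, hence \<open>[B]\<close>, hence all relations of \<open>p\<close>, since a factor
  \<open>h\<close> with \<open>h(p) \<noteq> 0\<close> can be divided out.
\<close>

lemma derivation_interpolation:
  assumes top: "\<And>k. k > r \<Longrightarrow> (w, k) \<notin> dvars B"
    and zero: "ev p B = 0" and S: "ev p (partial_deriv (w, r) B) \<noteq> 0"
    and ideal: "\<And>f. ev p f = 0 \<Longrightarrow> \<exists>h. ev p h \<noteq> 0 \<and> h * f \<in> diff_ideal_gen B"
  shows "\<exists>\<Delta>. derivation_over \<iota> (diff_field_gen \<iota> (range p)) \<Delta> \<and>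
    (\<forall>v k. v \<noteq> w \<longrightarrow> \<Delta> (jet p (v, k)) = 0) \<and> (\<forall>j<r. \<Delta> (jet p (w, j)) = c j)"
proof -
  let ?B = "\<lambda>i. (dpoly_der ^^ i) B"
  define M where "M i j = ev p (partial_deriv (w, j) (?B i))" for i j
  note order = higher_derivative_order[of r w B, OF top]
  have "M i (r + i) \<noteq> 0" for i using order[of i] S by (simp add: M_def)
  then obtain \<eta> where \<eta>: "\<And>j. j < r \<Longrightarrow> \<eta> j = c j" "\<And>i. (\<Sum>j\<le>r + i. M i j * \<eta> j) = 0"
    using triangular_system_solvable[of M r c] by blast
  define \<xi> where "\<xi> x = (if fst x = w then \<eta> (snd x) else 0)" for x
  let ?D = "dir_deriv \<iota> (jet p) \<xi>"
  have DB: "?D (?B i) = 0" for i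
  proof -
    let ?I = "Pair w ` {..r + i}"
    have "?D (?B i) = (\<Sum>x\<in>?I \<union> dvars (?B i). ev p (partial_deriv x (?B i)) * \<xi> x)"
      by (rule dir_deriv_superset) auto
    also have "\<dots> = (\<Sum>x\<in>?I. ev p (partial_deriv x (?B i)) * \<xi> x)"
    proof (rule sum.mono_neutral_right)
      show "\<forall>x\<in>?I \<union> dvars (?B i) - ?I. ev p (partial_deriv x (?B i)) * \<xi> x = 0"
      proof
        fix x assume x: "x \<in> ?I \<union> dvars (?B i) - ?I"
        have "fst x \<noteq> w"
        proof
          assume "fst x = w"
          then obtain k where k: "x = (w, k)" by (cases x) auto
          with x have "k > r + i" by (auto simp: not_le)
          with order[of i] k x show False by blast
        qed
        then show "ev p (partial_deriv x (?B i)) * \<xi> x = 0" by (simp add: \<xi>_def)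
      qed
    qed auto
    also have "\<dots> = (\<Sum>j\<le>r + i. M i j * \<eta> j)"
      by (subst sum.reindex) (auto simp: inj_on_def M_def \<xi>_def)
    finally show ?thesis using \<eta>(2) by simp
  qed
  have "?D f = 0" if f: "ev p f = 0" for f
  proof -
    obtain h where h: "ev p h \<noteq> 0" "h * f \<in> diff_ideal_gen B" using ideal[OF f] by blast
    then obtain n g where hf: "h * f = (\<Sum>i<n. g i * ?B i)"
      using diff_ideal_gen_subset[of B] unfolding ideal_below_def by blast
    have "ev p (?B i) = 0" for i by (simp add: poly_eval_higher_derivative zero)
    then have "?D (h * f) = 0" unfolding hf by (simp add: dir_deriv_sum dir_deriv_mult DB)
    then show ?thesis using h(1) f by (simp add: dir_deriv_mult)
  qed
  then obtain \<Delta> where "derivation_over \<iota> (diff_field_gen \<iota> (range p)) \<Delta>" "\<And>x. \<Delta> (jet p x) = \<xi> x"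
    using derivation_extension by metis
  then show ?thesis using \<eta>(1) by (intro exI[of _ \<Delta>]) (auto simp: \<xi>_def)
qed

end

lemma derivation_dimension_le:
  fixes m t :: nat
  assumes interpolate: "\<And>c. \<exists>\<Delta>. derivation_over \<iota> L \<Delta> \<and> (\<forall>x\<in>X. \<Delta> x = 0) \<and> (\<forall>i<m. \<Delta> (P i) = c i)"
    and determine: "\<And>\<Delta> i. derivation_over \<iota> L \<Delta> \<Longrightarrow> \<forall>x\<in>X. \<Delta> x = 0 \<Longrightarrow> \<forall>j<t. \<Delta> (Q j) = 0 \<Longrightarrow> \<Delta> (P i) = 0"
  shows "m \<le> t"
proof (rule interpolation_le_determination)
  let ?V = "{\<Delta>. derivation_over \<iota> L \<Delta> \<and> (\<forall>x\<in>X. \<Delta> x = 0)}"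
  show "(\<lambda>x. \<Sum>i<m. c i * f i x) \<in> ?V" if "\<And>i. i < m \<Longrightarrow> f i \<in> ?V" for f c
    using that by (auto intro!: derivation_over_linear_combination sum.neutral)
  show "\<exists>f\<in>?V. \<forall>i<m. f (P i) = c i" for c using interpolate[of c] by blast
  show "f (P i) = 0" if "f \<in> ?V" "\<forall>j<t. f (Q j) = 0" for f i using determine that by blast
qed

section \<open>The equation of a rational function\<close>

text \<open>
  With any linear order of the indeterminates the ring of differential polynomials is seen to be an integral
  domain.
\<close>

instantiation plane_var :: linorder
begin

definition less_eq_plane_var :: "plane_var \<Rightarrow> plane_var \<Rightarrow> bool" where
  "less_eq_plane_var x y \<longleftrightarrow> x = Xvar \<or> y = Yvar"

definition less_plane_var :: "plane_var \<Rightarrow> plane_var \<Rightarrow> bool" where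
  "less_plane_var x y \<longleftrightarrow> x = Xvar \<and> y = Yvar"

instance
  by standard (auto simp: less_eq_plane_var_def less_plane_var_def intro: plane_var.exhaust)

end

lemma plane_var_cases: "(v :: plane_var) \<noteq> w \<Longrightarrow> x = v \<or> x = w"
  by (cases v; cases w; cases x) auto

text \<open>
  The embedding of \<open>\<F>{u}\<close> that renames \<open>u\<close> to \<open>w\<close>.
\<close>

definition in_var :: "'v \<Rightarrow> (unit, 'a::differential_field) dpoly \<Rightarrow> ('v, 'a) dpoly" where
  "in_var w = poly_eval dconst (\<lambda>x. dvar (w, snd x))"

lemma coeff_hom_dconst: "coeff_hom (dconst :: 'a::differential_field \<Rightarrow> ('v, 'a) dpoly)"
  by standard (auto simp: dconst_add dconst_mult)

lemma in_var_const [simp]: "in_var w (dconst c) = dconst c"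
  and in_var_1 [simp]: "in_var w 1 = 1"
  and in_var_var: "in_var w (dvar x) = dvar (w, snd x)"
  and in_var_add: "in_var w (f + g) = in_var w f + in_var w g"
  and in_var_mult: "in_var w (f * g) = in_var w f * in_var w g"
  and in_var_diff: "in_var w (f - g) = in_var w f - in_var w g"
  unfolding in_var_def
  by (simp_all add: coeff_hom.poly_eval_add[OF coeff_hom_dconst] coeff_hom.poly_eval_mult[OF coeff_hom_dconst]
      coeff_hom.poly_eval_const[OF coeff_hom_dconst] coeff_hom.poly_eval_1[OF coeff_hom_dconst]
      coeff_hom.poly_eval_var[OF coeff_hom_dconst] coeff_hom.poly_eval_diff[OF coeff_hom_dconst])

lemma in_var_0 [simp]: "in_var w 0 = 0"
  by (metis in_var_const dconst_simps(1))

lemma dpoly_der_in_var: "dpoly_der (in_var w f) = in_var w (dpoly_der f)"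
  by (induction f rule: dpoly_induct)
    (auto simp: in_var_var in_var_add in_var_mult dpoly_der_add dpoly_der_mult)

lemma partial_deriv_in_var: "partial_deriv (w, k) (in_var w f) = in_var w (partial_deriv ((), k) f)"
proof (induction f rule: dpoly_induct)
  case (const c)
  then show ?case by simp
next
  case (var x)
  then show ?case by (cases x) (auto simp: in_var_var partial_deriv_var)
qed (auto simp: in_var_add in_var_mult partial_deriv_add partial_deriv_mult)

lemma (in diff_hom) ev_in_var: "ev p (in_var w f) = ev (\<lambda>_. p w) f"
  by (induction f rule: dpoly_induct)
    (auto simp: in_var_var in_var_add in_var_mult poly_eval_add poly_eval_mult jet_def)

text \<open>
  It vanishes at the point with \<open>v = P(u)/Q(u)\<close> and \<open>w = u\<close>.
\<close>

definition fraction_equation ::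
    "'v \<Rightarrow> 'v \<Rightarrow> (unit, 'a::differential_field) dpoly \<Rightarrow> (unit, 'a) dpoly \<Rightarrow> ('v, 'a) dpoly" where
  "fraction_equation v w P Q = in_var w Q * dvar (v, 0) - in_var w P"

lemma partial_deriv_fraction_equation:
  "v \<noteq> w \<Longrightarrow> partial_deriv (w, k) (fraction_equation v w P Q)
    = fraction_equation v w (partial_deriv ((), k) P) (partial_deriv ((), k) Q)"
  by (simp add: fraction_equation_def partial_deriv_diff partial_deriv_mult partial_deriv_in_var
      partial_deriv_var)

lemma diff_ideal_gen_diff:
  "f \<in> diff_ideal_gen B \<Longrightarrow> g \<in> diff_ideal_gen B \<Longrightarrow> f - g \<in> diff_ideal_gen B"
  using diff_ideal_gen_add[of f B "- 1 * g"] diff_ideal_gen_mult[of g B "- 1"] by simp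

text \<open>
  The equation expresses \<open>v\<close> as \<open>P(w)/Q(w)\<close>, so its derivatives express each \<open>v\<^sup>(\<^sup>k\<^sup>)\<close> as a polynomial in
  \<open>w\<close> and its derivatives divided by a power of \<open>Q(w)\<close>.
\<close>

lemma reduce_mod_fraction_equation:
  fixes v w :: plane_var
  assumes "v \<noteq> w"
  shows "\<exists>N g. in_var w (Q ^ N) * f - in_var w g \<in> diff_ideal_gen (fraction_equation v w P Q)"
    (is "\<exists>N g. ?red f N g")
proof (induction f rule: dpoly_induct)
  case (const c)
  have "?red (dconst c) 0 (dconst c)" by (simp add: diff_ideal_gen_0)
  then show ?case by blast
next
  case (var x)
  obtain y k where x: "x = (y, k)" by (cases x)
  have v: "\<exists>N g. ?red (dvar (v, k)) N g"
  proof (induction k)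
    case 0
    have "?red (dvar (v, 0)) 1 P"
      using diff_ideal_gen_generator[of "fraction_equation v w P Q"] by (simp add: fraction_equation_def)
    then show ?case by blast
  next
    case (Suc k)
    then obtain N g where red: "?red (dvar (v, k)) N g" by blast
    define q where "q = in_var w (Q ^ N)"
    \<comment> \<open>Differentiating \<open>q v\<^sup>(\<^sup>k\<^sup>) = g\<close> leaves a term \<open>q' v\<^sup>(\<^sup>k\<^sup>)\<close>, which the relation itself removes after
      multiplication by \<open>q\<close>.\<close>
    have "q * dpoly_der (q * dvar (v, k) - in_var w g)
        - dpoly_der q * (q * dvar (v, k) - in_var w g)
        \<in> diff_ideal_gen (fraction_equation v w P Q)"
      unfolding q_def
      by (rule diff_ideal_gen_diff[OF diff_ideal_gen_mult[OF diff_ideal_gen_der[OF red]] diff_ideal_gen_mult[OF red]])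
    also have "q * dpoly_der (q * dvar (v, k) - in_var w g)
        - dpoly_der q * (q * dvar (v, k) - in_var w g)
      = q * q * dvar (v, Suc k) - (q * dpoly_der (in_var w g) - dpoly_der q * in_var w g)"
      by (simp add: dpoly_der_diff dpoly_der_mult algebra_simps)
    also have "\<dots> = in_var w (Q ^ (N + N)) * dvar (v, Suc k)
        - in_var w (Q ^ N * dpoly_der g - dpoly_der (Q ^ N) * g)"
      by (simp only: q_def power_add in_var_mult in_var_diff dpoly_der_in_var)
    finally show ?case by blast
  qed
  have w: "?red (dvar (w, k)) 0 (dvar ((), k))" by (simp add: in_var_var diff_ideal_gen_0)
  show ?case using plane_var_cases[OF assms, of y] v w unfolding x by blast
next
  case (add f1 f2)
  then obtain N1 g1 N2 g2 where red: "?red f1 N1 g1" "?red f2 N2 g2" by blast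
  have "in_var w (Q ^ N2) * (in_var w (Q ^ N1) * f1 - in_var w g1)
      + in_var w (Q ^ N1) * (in_var w (Q ^ N2) * f2 - in_var w g2)
      \<in> diff_ideal_gen (fraction_equation v w P Q)"
    using red by (intro diff_ideal_gen_add diff_ideal_gen_mult)
  also have "in_var w (Q ^ N2) * (in_var w (Q ^ N1) * f1 - in_var w g1)
      + in_var w (Q ^ N1) * (in_var w (Q ^ N2) * f2 - in_var w g2)
      = in_var w (Q ^ (N1 + N2)) * (f1 + f2) - in_var w (Q ^ N2 * g1 + Q ^ N1 * g2)"
    by (simp add: power_add in_var_mult in_var_add algebra_simps)
  finally show ?case by blast
next
  case (mult f1 f2)
  then obtain N1 g1 N2 g2 where red: "?red f1 N1 g1" "?red f2 N2 g2" by blast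
  have "in_var w (Q ^ N2) * f2 * (in_var w (Q ^ N1) * f1 - in_var w g1)
      + in_var w g1 * (in_var w (Q ^ N2) * f2 - in_var w g2)
      \<in> diff_ideal_gen (fraction_equation v w P Q)"
    using red by (intro diff_ideal_gen_add diff_ideal_gen_mult)
  also have "in_var w (Q ^ N2) * f2 * (in_var w (Q ^ N1) * f1 - in_var w g1)
      + in_var w g1 * (in_var w (Q ^ N2) * f2 - in_var w g2)
      = in_var w (Q ^ (N1 + N2)) * (f1 * f2) - in_var w (g1 * g2)"
    by (simp add: power_add in_var_mult algebra_simps)
  finally show ?case by blast
qed

lemma dord_cases:
  obtains (none) "dord v f = - \<infinity>" "\<And>k. (v, k) \<notin> dvars f"
  | (order) r where "dord v f = ereal (real r)" "(v, r) \<in> dvars f" "\<And>k. k > r \<Longrightarrow> (v, k) \<notin> dvars f"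
proof (cases "{k. (v, k) \<in> dvars f} = {}")
  case True
  show ?thesis by (rule none) (use True in \<open>auto simp: dord_def\<close>)
next
  case False
  let ?K = "{k. (v, k) \<in> dvars f}"
  have "?K \<subseteq> snd ` dvars f" by force
  then have fin: "finite ?K" by (rule finite_subset) simp
  have "Max ?K \<in> ?K" using fin False by (rule Max_in)
  moreover have "(v, k) \<notin> dvars f" if "k > Max ?K" for k
    using Max_ge[OF fin, of k] that by auto
  moreover have "dord v f = ereal (real (Max ?K))" using False by (simp only: dord_def if_False)
  ultimately show ?thesis using order[of "Max ?K"] by blast
qed

lemma frac_ord_cases:
  obtains (trivial) "frac_ord P Q = - \<infinity>" "dvars P = {}" "dvars Q = {}"
  | (order) m where "frac_ord P Q = ereal (real m)" "((), m) \<in> dvars P \<union> dvars Q"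
      "\<And>k. k > m \<Longrightarrow> ((), k) \<notin> dvars P \<union> dvars Q"
proof (cases rule: dord_cases[of "()" P])
  case none
  note P = none
  show ?thesis
  proof (cases rule: dord_cases[of "()" Q])
    case none
    have "dvars P = {}" "dvars Q = {}" using P(2) none(2) by auto
    moreover have "frac_ord P Q = - \<infinity>" using P(1) none(1) by (simp add: frac_ord_def)
    ultimately show ?thesis by (intro trivial)
  next
    case (order r)
    show ?thesis by (rule that(2)[of r]) (use P order in \<open>auto simp: frac_ord_def\<close>)
  qed
next
  case (order m)
  note P = order
  show ?thesis
  proof (cases rule: dord_cases[of "()" Q])
    case none
    show ?thesis by (rule that(2)[of m]) (use P none in \<open>auto simp: frac_ord_def\<close>)
  next
    case (order r)
    show ?thesis
    proof (rule that(2)[of "max m r"])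
      show "frac_ord P Q = ereal (real (max m r))"
        using P(1) order(1) by (cases "m \<le> r") (simp_all add: frac_ord_def max_def)
      show "((), max m r) \<in> dvars P \<union> dvars Q" using P(2) order(2) by (simp add: max_def)
      show "((), k) \<notin> dvars P \<union> dvars Q" if "k > max m r" for k
        using P(3) order(3) that by simp
    qed
  qed
qed

context diff_hom
begin

text \<open>
  Up to sign and the factor \<open>1/Q\<^sup>2\<close> this is \<open>\<partial>(P/Q)/\<partial>u\<^sup>(\<^sup>m\<^sup>)\<close>. If it vanished, \<open>Q\<close> would divide
  \<open>P \<partial>Q/\<partial>u\<^sup>(\<^sup>m\<^sup>)\<close> and, being coprime to \<open>P\<close>, also \<open>\<partial>Q/\<partial>u\<^sup>(\<^sup>m\<^sup>)\<close>. For reasons of degree that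
  derivative is then zero, and so is \<open>\<partial>P/\<partial>u\<^sup>(\<^sup>m\<^sup>)\<close>.
\<close>

lemma reduced_fraction_jacobian_nonzero:
  assumes trans: "differentially_transcendental \<iota> u" and red: "reduced_form P Q"
    and m: "((), m) \<in> dvars P \<union> dvars Q"
  shows "ev (\<lambda>_. u) (partial_deriv ((), m) Q * P - partial_deriv ((), m) P * Q) \<noteq> 0"
proof
  let ?Pm = "partial_deriv ((), m) P" and ?Qm = "partial_deriv ((), m) Q"
  assume "ev (\<lambda>_. u) (?Qm * P - ?Pm * Q) = 0"
  then have "?Qm * P - ?Pm * Q = 0"
    using trans unfolding differentially_transcendental_def dpoly_eval_eq by blast
  then have eq: "P * ?Qm = Q * ?Pm" by (simp add: mult.commute)
  have Q0: "Q \<noteq> 0" using red by (simp add: reduced_form_def)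
  have "Q dvd P * ?Qm" unfolding eq by (rule dvd_triv_left)
  have "d dvd 1" if "d dvd P" "d dvd Q" for d using red that unfolding reduced_form_def by blast
  then have "Q dvd ?Qm" using \<open>Q dvd P * ?Qm\<close> by (rule coprime_dvd_mult_dpoly[OF Q0])
  then have "?Qm = 0" using not_dvd_partial_deriv[of "((), m)" Q] by blast
  moreover from this have "?Pm = 0" using eq Q0 by simp
  ultimately show False using m by (simp add: partial_deriv_eq_0_iff)
qed

text \<open>
  These are the hypotheses of \<open>derivation_interpolation\<close> for the point \<open>(a, u)\<close>. For the last one, a relation
  of the point is reduced to a polynomial in \<open>w\<close> alone, which vanishes at \<open>u\<close> and is therefore zero.
\<close>

lemma fraction_equation_properties:
  fixes v w :: plane_var
  assumes trans: "differentially_transcendental \<iota> u" and red: "reduced_form P Q"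
    and m: "((), m) \<in> dvars P \<union> dvars Q" "\<And>k. k > m \<Longrightarrow> ((), k) \<notin> dvars P \<union> dvars Q"
    and vw: "v \<noteq> w" and p: "p w = u" "p v = frac_eval \<iota> u P Q"
  shows "\<And>k. k > m \<Longrightarrow> (w, k) \<notin> dvars (fraction_equation v w P Q)"
    and "ev p (fraction_equation v w P Q) = 0"
    and "ev p (partial_deriv (w, m) (fraction_equation v w P Q)) \<noteq> 0"
    and "\<And>f. ev p f = 0 \<Longrightarrow> \<exists>h. ev p h \<noteq> 0 \<and> h * f \<in> diff_ideal_gen (fraction_equation v w P Q)"
proof -
  let ?B = "fraction_equation v w P Q"
  have trans0: "f = 0" if "ev (\<lambda>_. u) f = 0" for f :: "(unit, 'a) dpoly"
    using trans that unfolding differentially_transcendental_def dpoly_eval_eq by blast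
  have Q0: "ev (\<lambda>_. u) Q \<noteq> 0" using red trans0[of Q] unfolding reduced_form_def by blast
  have a: "p v = ev (\<lambda>_. u) P / ev (\<lambda>_. u) Q" using p(2) by (simp add: frac_eval_def dpoly_eval_eq)
  have ev_eq: "ev p (fraction_equation v w f g) = ev (\<lambda>_. u) g * p v - ev (\<lambda>_. u) f" for f g
    by (simp add: fraction_equation_def poly_eval_diff poly_eval_mult ev_in_var p(1) jet_def)
  show B0: "ev p ?B = 0" unfolding ev_eq a using Q0 by simp
  show "(w, k) \<notin> dvars ?B" if "k > m" for k
  proof -
    have "partial_deriv ((), k) P = 0" "partial_deriv ((), k) Q = 0"
      using m(2)[OF that] by (auto simp: partial_deriv_eq_0_iff)
    then have "partial_deriv (w, k) ?B = 0"
      unfolding partial_deriv_fraction_equation[OF vw] by (simp add: fraction_equation_def)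
    then show ?thesis by (simp only: partial_deriv_eq_0_iff not_False_eq_True)
  qed
  show "ev p (partial_deriv (w, m) ?B) \<noteq> 0"
    using reduced_fraction_jacobian_nonzero[OF trans red m(1)] Q0
    unfolding partial_deriv_fraction_equation[OF vw] ev_eq a
    by (simp add: poly_eval_diff poly_eval_mult field_simps)
  show "\<exists>h. ev p h \<noteq> 0 \<and> h * f \<in> diff_ideal_gen ?B" if f: "ev p f = 0" for f
  proof -
    obtain N g where red: "in_var w (Q ^ N) * f - in_var w g \<in> diff_ideal_gen ?B"
      using reduce_mod_fraction_equation[OF vw] by blast
    then have "ev p (in_var w (Q ^ N) * f - in_var w g) = 0"
      using diff_ideal_gen_subset[of ?B] ev_ideal_below[OF B0] by blast
    then have "ev (\<lambda>_. u) g = 0"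
      using f by (simp add: poly_eval_diff poly_eval_mult ev_in_var p(1))
    then have "g = 0" by (rule trans0)
    then have "in_var w (Q ^ N) * f \<in> diff_ideal_gen ?B"
      using red by simp
    moreover have "ev p (in_var w (Q ^ N)) \<noteq> 0"
      using Q0 by (simp add: ev_in_var p(1) poly_eval_power)
    ultimately show ?thesis by blast
  qed
qed

text \<open>
  As \<open>u\<close> satisfies no relation, every tangent vector extends; the space of derivations of \<open>\<F>\<langle>u\<rangle>\<close> over
  \<open>\<F>\<close> has infinite dimension.
\<close>

lemma interpolation_transcendental:
  assumes "differentially_transcendental \<iota> u"
  shows "\<exists>\<Delta>. derivation_over \<iota> (diff_field_gen \<iota> {u}) \<Delta> \<and> (\<forall>i. \<Delta> ((der ^^ i) u) = c i)"
proof -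
  let ?p = "\<lambda>_::unit. u"
  have "f = 0" if "ev ?p f = 0" for f
    using assms that unfolding differentially_transcendental_def dpoly_eval_eq by blast
  then have "dir_deriv \<iota> (jet ?p) (\<lambda>x. c (snd x)) f = 0" if "ev ?p f = 0" for f
    using that by fastforce
  then obtain \<Delta> where \<Delta>: "derivation_over \<iota> (diff_field_gen \<iota> (range ?p)) \<Delta>"
      "\<And>x. \<Delta> (jet ?p x) = c (snd x)"
    using derivation_extension[of ?p "\<lambda>x. c (snd x)"] by blast
  have "\<Delta> ((der ^^ i) u) = c i" for i using \<Delta>(2)[of "((), i)"] by (simp add: jet_def)
  moreover have "range ?p = {u}" by auto
  ultimately show ?thesis using \<Delta>(1) by (intro exI[of _ \<Delta>]) simp
qed

text \<open>
  The orders agree because both are the dimension of the space of derivations of \<open>L\<close> that vanish on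
  \<open>X = {a, a', a'', \<dots>}\<close>. One has coordinates \<open>\<Delta>(u\<^sup>(\<^sup>i\<^sup>))\<close> on it from the equation of \<open>P/Q\<close>, and
  coordinates \<open>\<Delta>(w\<^sup>(\<^sup>j\<^sup>))\<close> from \<open>A\<close>. Stating this for an arbitrary indeterminate \<open>v\<close> and the remaining one
  \<open>w\<close> covers both coordinates of the parametrization.
\<close>

lemma frac_ord_eq_dord:
  fixes v w :: plane_var and A :: "'a plane_dpoly"
  assumes trans: "differentially_transcendental \<iota> u" and red: "reduced_form P Q"
    and vw: "v \<noteq> w" and irr: "irreducible A"
    and p: "p v = frac_eval \<iota> u P Q" and gen: "diff_field_gen \<iota> (range p) = diff_field_gen \<iota> {u}"
    and ideal: "vanishing_ideal \<iota> p = sat rk A"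
  shows "frac_ord P Q = dord w A"
proof -
  define L where "L = diff_field_gen \<iota> {u}"
  define a where "a = frac_eval \<iota> u P Q"
  define U where "U i = (der ^^ i) u" for i
  have Lp: "diff_field_gen \<iota> (range p) = L" using gen by (simp add: L_def)
  have UL: "U i \<in> L" for i unfolding U_def L_def by (intro diff_field_gen_higher_der diff_field_gen_gen) simp
  have jv: "jet p (v, k) = (der ^^ k) a" for k by (simp add: jet_def p a_def)
  define pu where "pu x = (if x = w then u else a)" for x
  have range_pu: "range pu = {a, u}"
  proof -
    have "pu v = a" "pu w = u" using vw by (auto simp: pu_def)
    then have "{a, u} \<subseteq> range pu" by blast
    then show ?thesis by (auto simp: pu_def)
  qed
  have Lpu: "diff_field_gen \<iota> (range pu) = L"
  proof
    have "a \<in> L" using diff_field_gen_gen[OF rangeI[of p v], of \<iota>] unfolding p Lp a_def .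
    then have "{a, u} \<subseteq> L" using UL[of 0] by (simp add: U_def)
    then show "diff_field_gen \<iota> (range pu) \<subseteq> L"
      unfolding range_pu L_def
      by (intro diff_field_gen_least differential_subfield_diff_field_gen) (auto intro: diff_field_gen_base)
    show "L \<subseteq> diff_field_gen \<iota> (range pu)"
      unfolding range_pu L_def
      by (intro diff_field_gen_least differential_subfield_diff_field_gen)
        (auto intro: diff_field_gen_base diff_field_gen_gen)
  qed
  have jpu: "jet pu (w, k) = U k" "jet pu (v, k) = (der ^^ k) a" for k
    using vw by (auto simp: jet_def pu_def U_def)

  have ev_iff: "ev p f = 0 \<longleftrightarrow> f \<in> sat rk A" for f
    using ideal unfolding vanishing_ideal_def dpoly_eval_eq by blast
  define S where "S = separant rk A"
  have sat: "f \<in> sat rk A \<longleftrightarrow> (\<exists>k. S ^ k * f \<in> diff_ideal_gen A)" for f by (simp add: sat_def S_def)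
  \<comment> \<open>If the separant vanished at \<open>p\<close>, it would lie in its own saturation, which would then contain 1.\<close>
  have evS: "ev p S \<noteq> 0"
  proof
    assume "ev p S = 0"
    then obtain k where "S ^ k * S \<in> diff_ideal_gen A" using ev_iff sat by blast
    then have "S ^ Suc k * 1 \<in> diff_ideal_gen A" by (simp add: mult.commute)
    then have "ev p 1 = 0" using ev_iff sat by blast
    then show False by simp
  qed
  have A0: "ev p A = 0"
  proof -
    have "S ^ 0 * A \<in> diff_ideal_gen A" by (simp add: diff_ideal_gen_generator)
    then show ?thesis using ev_iff sat by blast
  qed
  have SA: "ev p (partial_deriv (x, q) A) \<noteq> 0"
    if x: "(x, q) \<in> dvars A" "\<And>k. k > q \<Longrightarrow> (x, k) \<notin> dvars A" for x q
  proof
    assume "ev p (partial_deriv (x, q) A) = 0"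
    then obtain k where "S ^ k * partial_deriv (x, q) A \<in> diff_ideal_gen A" using ev_iff sat by blast
    moreover have "partial_deriv (leader rk A) A \<noteq> 0" using evS by (auto simp: S_def separant_def)
    ultimately show False
      using partial_deriv_not_in_saturation[OF irr x] by (simp add: S_def separant_def)
  qed
  have idealA: "\<exists>h. ev p h \<noteq> 0 \<and> h * f \<in> diff_ideal_gen A" if f: "ev p f = 0" for f
  proof -
    obtain k where "S ^ k * f \<in> diff_ideal_gen A" using f ev_iff sat by blast
    moreover have "ev p (S ^ k) \<noteq> 0" using evS by (simp add: poly_eval_power)
    ultimately show ?thesis by blast
  qed

  define X where "X = range (\<lambda>k. (der ^^ k) a)"
  have determine_u: "\<Delta> x = 0"
    if \<Delta>: "derivation_over \<iota> L \<Delta>" "\<forall>x\<in>X. \<Delta> x = 0" "\<And>j. j < m \<Longrightarrow> \<Delta> (U j) = 0" and x: "x \<in> L"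
      and m: "((), m) \<in> dvars P \<union> dvars Q" "\<And>k. k > m \<Longrightarrow> ((), k) \<notin> dvars P \<union> dvars Q" for \<Delta> x m
  proof -
    have pu: "pu w = u" "pu v = frac_eval \<iota> u P Q" using vw by (auto simp: pu_def a_def)
    note B = fraction_equation_properties[OF trans red m vw pu]
    have v: "\<Delta> (jet pu (v, k)) = 0" for k using \<Delta>(2) unfolding jpu X_def by blast
    have "\<Delta> (jet pu (w, j)) = 0" for j
    proof (rule derivation_determined_by_equation[OF _ B(1-3)])
      show "derivation_over \<iota> (diff_field_gen \<iota> (range pu)) \<Delta>" using \<Delta>(1) Lpu by simp
      show "(\<forall>k. \<Delta> (jet pu (y, k)) = 0) \<or> (\<forall>k. (y, k) \<notin> dvars (fraction_equation v w P Q))"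
        if "y \<noteq> w" for y
        using plane_var_cases[OF vw, of y] that v by blast
      show "\<Delta> (jet pu (w, j)) = 0" if "j < m" for j using \<Delta>(3)[OF that] by (simp add: jpu)
    qed
    then have "\<Delta> (jet pu y) = 0" for y
      using plane_var_cases[OF vw, of "fst y"] v by (cases y) auto
    then show ?thesis using derivation_eq_0_if_jet_eq_0[of pu \<Delta> x] \<Delta>(1) x Lpu by simp
  qed
  have determine_A: "\<Delta> x = 0"
    if \<Delta>: "derivation_over \<iota> L \<Delta>" "\<forall>x\<in>X. \<Delta> x = 0" "\<And>j. j < t \<Longrightarrow> \<Delta> (jet p (w, j)) = 0" and x: "x \<in> L"
      and t: "(w, t) \<in> dvars A" "\<And>k. k > t \<Longrightarrow> (w, k) \<notin> dvars A" for \<Delta> x t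
  proof -
    have v: "\<Delta> (jet p (v, k)) = 0" for k using \<Delta>(2) unfolding jv X_def by blast
    have "\<Delta> (jet p (w, j)) = 0" for j
    proof (rule derivation_determined_by_equation[OF _ t(2) A0 SA[OF t]])
      show "derivation_over \<iota> (diff_field_gen \<iota> (range p)) \<Delta>" using \<Delta>(1) Lp by simp
      show "(\<forall>k. \<Delta> (jet p (y, k)) = 0) \<or> (\<forall>k. (y, k) \<notin> dvars A)" if "y \<noteq> w" for y
        using plane_var_cases[OF vw, of y] that v by blast
    qed (use \<Delta>(3) in auto)
    then have "\<Delta> (jet p y) = 0" for y
      using plane_var_cases[OF vw, of "fst y"] v by (cases y) auto
    then show ?thesis using derivation_eq_0_if_jet_eq_0[of p \<Delta> x] \<Delta>(1) x Lp by simp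
  qed

  show ?thesis
  proof (cases rule: frac_ord_cases[of P Q])
    case trivial
    show ?thesis
    proof (cases rule: dord_cases[of w A])
      case none
      then show ?thesis using trivial by simp
    next
      case (order t)
      \<comment> \<open>Now \<open>a\<close> lies in \<open>\<F>\<close>, so every derivation over \<open>\<F>\<close> vanishes on \<open>X\<close> and is determined by \<open>t\<close> values.\<close>
      obtain c d where cd: "P = dconst c" "Q = dconst d"
        using dpoly_const_if_dvars_empty[OF trivial(2)] dpoly_const_if_dvars_empty[OF trivial(3)] by blast
      have d: "d \<noteq> 0" using red cd(2) by (auto simp: reduced_form_def)
      have "\<iota> (c / d) * \<iota> d = \<iota> c" using d by (simp flip: hom_mult)
      moreover have "\<iota> d * \<iota> (inverse d) = 1" using d by (simp flip: hom_mult)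
      then have "\<iota> d \<noteq> 0" by auto
      ultimately have "a = \<iota> (c / d)"
        by (simp add: a_def frac_eval_def dpoly_eval_eq cd eq_divide_eq divide_eq_eq)
      then have ak: "(der ^^ k) a = \<iota> ((der ^^ k) (c / d))" for k
        by (induction k) (auto simp: hom_der)
      have "Suc t \<le> t"
      proof (rule derivation_dimension_le[where X = "{}" and L = L and P = U and Q = "\<lambda>j. jet p (w, j)"])
        show "\<exists>\<Delta>. derivation_over \<iota> L \<Delta> \<and> (\<forall>x\<in>{}. \<Delta> x = 0) \<and> (\<forall>i<Suc t. \<Delta> (U i) = e i)" for e
          using interpolation_transcendental[OF trans, of e] unfolding L_def U_def by blast
        show "\<Delta> (U i) = 0" if \<Delta>: "derivation_over \<iota> L \<Delta>" "\<forall>j<t. \<Delta> (jet p (w, j)) = 0" for \<Delta> i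
        proof (rule determine_A[OF \<Delta>(1) _ _ UL order(2,3)])
          show "\<forall>x\<in>X. \<Delta> x = 0" using \<Delta>(1) unfolding X_def ak derivation_over_def by blast
        qed (use \<Delta>(2) in auto)
      qed
      then show ?thesis by simp
    qed
  next
    case (order m)
    note m = order
    show ?thesis
    proof (cases rule: dord_cases[of w A])
      case (order t)
      have "m \<le> t"
      proof (rule derivation_dimension_le[where X = X and L = L and P = U and Q = "\<lambda>j. jet p (w, j)"])
        show "\<exists>\<Delta>. derivation_over \<iota> L \<Delta> \<and> (\<forall>x\<in>X. \<Delta> x = 0) \<and> (\<forall>i<m. \<Delta> (U i) = e i)" for e
        proof -
          have pu: "pu w = u" "pu v = frac_eval \<iota> u P Q" using vw by (auto simp: pu_def a_def)
          note B = fraction_equation_properties[OF trans red m(2,3) vw pu]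
          obtain \<Delta> where \<Delta>: "derivation_over \<iota> L \<Delta>" "\<And>y k. y \<noteq> w \<Longrightarrow> \<Delta> (jet pu (y, k)) = 0"
              "\<And>j. j < m \<Longrightarrow> \<Delta> (jet pu (w, j)) = e j"
            using derivation_interpolation[OF B, of e] unfolding Lpu by blast
          have "\<forall>x\<in>X. \<Delta> x = 0" using \<Delta>(2)[OF vw] unfolding X_def jpu by blast
          moreover have "\<forall>i<m. \<Delta> (U i) = e i" using \<Delta>(3) unfolding jpu by blast
          ultimately show ?thesis using \<Delta>(1) by blast
        qed
        show "\<Delta> (U i) = 0"
          if "derivation_over \<iota> L \<Delta>" "\<forall>x\<in>X. \<Delta> x = 0" "\<forall>j<t. \<Delta> (jet p (w, j)) = 0" for \<Delta> i
          using determine_A[OF that(1,2) _ UL order(2,3)] that(3) by blast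
      qed
      moreover have "t \<le> m"
      proof (rule derivation_dimension_le[where X = X and L = L and P = "\<lambda>j. jet p (w, j)" and Q = U])
        show "\<exists>\<Delta>. derivation_over \<iota> L \<Delta> \<and> (\<forall>x\<in>X. \<Delta> x = 0) \<and> (\<forall>i<t. \<Delta> (jet p (w, i)) = e i)" for e
        proof -
          obtain \<Delta> where \<Delta>: "derivation_over \<iota> L \<Delta>" "\<And>y k. y \<noteq> w \<Longrightarrow> \<Delta> (jet p (y, k)) = 0"
              "\<And>j. j < t \<Longrightarrow> \<Delta> (jet p (w, j)) = e j"
            using derivation_interpolation[OF order(3) A0 SA[OF order(2,3)] idealA, of e] unfolding Lp by blast
          have "\<forall>x\<in>X. \<Delta> x = 0" using \<Delta>(2)[OF vw] unfolding X_def jv by blast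
          with \<Delta>(1,3) show ?thesis by blast
        qed
        show "\<Delta> (jet p (w, i)) = 0"
          if "derivation_over \<iota> L \<Delta>" "\<forall>x\<in>X. \<Delta> x = 0" "\<forall>j<m. \<Delta> (U j) = 0" for \<Delta> i
          using determine_u[OF that(1,2) _ _ m(2,3)] that(3) jet_in_diff_field_gen[of p] Lp by blast
      qed
      ultimately show ?thesis using m(1) order(1) by simp
    next
      case none
      \<comment> \<open>Now \<open>A\<close> is an equation for \<open>a\<close> alone. A derivation over \<open>\<F>\<close> that vanishes at the first \<open>k\<close>
        derivatives of \<open>a\<close> vanishes on \<open>X\<close>, so \<open>k + m\<close> values determine it.\<close>
      have "dvars A \<noteq> {}"
      proof
        assume "dvars A = {}"
        then obtain c where c: "A = dconst c" using dpoly_const_if_dvars_empty by blast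
        have "A \<noteq> 0" "\<not> A dvd 1" using irr by (auto simp: irreducible_def)
        then show False using c dconst_dvd_1[of c] by (cases "c = 0") auto
      qed
      then obtain x where x: "x \<in> dvars A" by blast
      obtain y k0 where "x = (y, k0)" by (cases x)
      with x have "(y, k0) \<in> dvars A" by simp
      then have "(v, k0) \<in> dvars A" using none(2) plane_var_cases[OF vw, of y] by blast
      then obtain k where k: "(v, k) \<in> dvars A" "\<And>j. j > k \<Longrightarrow> (v, j) \<notin> dvars A"
        by (cases rule: dord_cases[of v A]) auto
      define R where "R j = (if j < k then (der ^^ j) a else U (j - k))" for j
      have "Suc (k + m) \<le> k + m"
      proof (rule derivation_dimension_le[where X = "{}" and L = L and P = U and Q = R])
        show "\<exists>\<Delta>. derivation_over \<iota> L \<Delta> \<and> (\<forall>x\<in>{}. \<Delta> x = 0) \<and> (\<forall>i<Suc (k + m). \<Delta> (U i) = e i)" for e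
          using interpolation_transcendental[OF trans, of e] unfolding L_def U_def by blast
        show "\<Delta> (U i) = 0" if \<Delta>: "derivation_over \<iota> L \<Delta>" "\<forall>j<k + m. \<Delta> (R j) = 0" for \<Delta> i
        proof (rule determine_u[OF \<Delta>(1) _ _ UL m(2,3)])
          have "\<Delta> (jet p (v, j)) = 0" for j
          proof (rule derivation_determined_by_equation[OF _ k(2) A0 SA[OF k]])
            show "derivation_over \<iota> (diff_field_gen \<iota> (range p)) \<Delta>" using \<Delta>(1) Lp by simp
            show "(\<forall>k. \<Delta> (jet p (y, k)) = 0) \<or> (\<forall>k. (y, k) \<notin> dvars A)" if "y \<noteq> v" for y
              using plane_var_cases[OF vw, of y] that none(2) by blast
            show "\<Delta> (jet p (v, j)) = 0" if "j < k" for j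
              using \<Delta>(2)[rule_format, of j] that by (simp add: R_def jv)
          qed
          then show "\<forall>x\<in>X. \<Delta> x = 0" unfolding X_def jv by blast
          show "\<Delta> (U j) = 0" if "j < m" for j
            using \<Delta>(2)[rule_format, of "k + j"] that by (simp add: R_def)
        qed
      qed
      then show ?thesis by simp
    qed
  qed
qed

end

theorem theorem3p7:
  fixes \<iota> :: "'f::differential_field \<Rightarrow> 'e::differential_field"
    and u :: 'e
    and rk :: "plane_var \<times> nat \<Rightarrow> plane_var \<times> nat \<Rightarrow> bool"
    and A :: "'f plane_dpoly"
    and P\<^sub>1 Q\<^sub>1 P\<^sub>2 Q\<^sub>2 :: "(unit, 'f) dpoly"
  assumes "universal_extension \<iota>"
    and "differentially_transcendental \<iota> u"
    and "ranking rk"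
    and "irreducible A"
    and "unirational \<iota> u rk A"
    and "rational_parametrization \<iota> u rk A P\<^sub>1 Q\<^sub>1 P\<^sub>2 Q\<^sub>2"
    and "proper_parametrization \<iota> u P\<^sub>1 Q\<^sub>1 P\<^sub>2 Q\<^sub>2"
  shows "frac_ord P\<^sub>1 Q\<^sub>1 = dord Yvar A \<and> frac_ord P\<^sub>2 Q\<^sub>2 = dord Xvar A"
proof -
  interpret diff_hom \<iota>
    using assms(1) by (intro diff_hom_if_differential_extension) (simp add: universal_extension_def)
  define p where "p = case_plane_var (frac_eval \<iota> u P\<^sub>1 Q\<^sub>1) (frac_eval \<iota> u P\<^sub>2 Q\<^sub>2)"
  have pv: "p Xvar = frac_eval \<iota> u P\<^sub>1 Q\<^sub>1" "p Yvar = frac_eval \<iota> u P\<^sub>2 Q\<^sub>2" by (auto simp: p_def)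
  have UNIV_eq: "UNIV = {Xvar, Yvar}" using plane_var.exhaust by blast
  have "range p = {frac_eval \<iota> u P\<^sub>1 Q\<^sub>1, frac_eval \<iota> u P\<^sub>2 Q\<^sub>2}"
    unfolding UNIV_eq by (simp add: pv)
  with assms(7) have gen: "diff_field_gen \<iota> (range p) = diff_field_gen \<iota> {u}"
    by (simp add: proper_parametrization_def)
  from assms(6) have red: "reduced_form P\<^sub>1 Q\<^sub>1" "reduced_form P\<^sub>2 Q\<^sub>2"
    and ideal: "vanishing_ideal \<iota> p = sat rk A"
    unfolding rational_parametrization_def generic_point_def p_def by blast+
  have "frac_ord P\<^sub>1 Q\<^sub>1 = dord Yvar A"
    by (rule frac_ord_eq_dord[OF assms(2) red(1) _ assms(4) pv(1) gen ideal]) simp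
  moreover have "frac_ord P\<^sub>2 Q\<^sub>2 = dord Xvar A"
    by (rule frac_ord_eq_dord[OF assms(2) red(2) _ assms(4) pv(2) gen ideal]) simp
  ultimately show ?thesis ..
qed

end
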